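(* Let $m\in\{2,3\}$. For every positive integer $n$ and every $p\in(0,1]$ there exists a $p$-sample for $[n]^m$ that admits fast summation. Moreover, when $m=2$ the summation algorithm runs in $O(n)$ time, and when $m=3$ it runs in $O(n\log^2 n)$ time.
   Context: For a finite set $T$, a random subset $S\subseteq T$ is a $p$-sample for $T$ if (1) for all $i\in T$, $p/2\le\Pr(i\in S)\le p$, and (2) for all $j\ne i$ in $T$, $\Pr(j\in S\mid i\in S)\le 2p$. A (random) subset $S\subseteq[n]^m=[n]\times\cdots\times[n]$ admits fast summation if there is an algorithm which, for arbitrary vectors $x^{(1)},\dots,x^{(m)}\in\mathbb R^n$, computes $\sum_{(i_1,\dots,i_m)\in S}x^{(1)}_{i_1}x^{(2)}_{i_2}\cdots x^{(m)}_{i_m}$ in $\tilde O(mn)$ time, where $\tilde O(f)$ means $O(f\log^c f)$ for some constant $c$. Here $[n]=\{1,\dots,n\}$. *)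

theory Defs
  imports "HOL-Probability.Probability" "HOL-Library.Landau_Symbols"
begin

definition p_sample :: "real \<Rightarrow> 'a set \<Rightarrow> 'a set pmf \<Rightarrow> bool" where
  "p_sample p T D \<longleftrightarrow>
     finite T \<and> set_pmf D \<subseteq> Pow T \<and>
     (\<forall>i\<in>T. p / 2 \<le> measure_pmf.prob D {S. i \<in> S} \<and> measure_pmf.prob D {S. i \<in> S} \<le> p) \<and>
     (\<forall>i\<in>T. \<forall>j\<in>T. j \<noteq> i \<longrightarrow> \<P>(S in measure_pmf D. j \<in> S \<bar> i \<in> S) \<le> 2 * p)"

definition grid :: "nat \<Rightarrow> nat \<Rightarrow> (nat \<Rightarrow> nat) set" where
  "grid n m = {1..m} \<rightarrow>\<^sub>E {1..n}"

definition product_sum :: "nat \<Rightarrow> (nat \<Rightarrow> nat) set \<Rightarrow> (nat \<Rightarrow> nat \<Rightarrow> real) \<Rightarrow> real" where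
  "product_sum m S x = (\<Sum>i\<in>S. \<Prod>k\<in>{1..m}. x k (i k))"

text \<open>
  Algorithms are programs of a real RAM with unit-cost operations. The memory consists of arrays
  (named by literals of the program, so a program uses finitely many) of machine words and arrays
  of real numbers. Word arithmetic is modulo \<open>q\<close>, where \<open>q\<close> will be polynomial in \<open>n\<close>, that is,
  words have \<open>O(log n)\<close> bits. Reals are exact, with the four field operations, conversion
  from words and comparisons; there is no conversion from reals to words.
\<close>

datatype wexp =
    WConst nat
  | WRead nat wexp
  | WAdd wexp wexp
  | WSub wexp wexp
  | WMul wexp wexp
  | WDiv wexp wexp
  | WMod wexp wexp

datatype rexp =
    ROfWord wexp
  | RRead nat wexp
  | RAdd rexp rexp
  | RSub rexp rexp
  | RMul rexp rexp
  | RDiv rexp rexp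

datatype test = WLess wexp wexp | RLess rexp rexp

datatype prog =
    Skip
  | WWrite nat wexp wexp
  | RWrite nat wexp rexp
  | Seq prog prog
  | Cond test prog prog
  | Loop test prog

type_synonym words = "nat \<Rightarrow> nat \<Rightarrow> nat"
type_synonym reals = "nat \<Rightarrow> nat \<Rightarrow> real"

primrec wval :: "nat \<Rightarrow> words \<Rightarrow> wexp \<Rightarrow> nat" where
  "wval q W (WConst c) = c mod q"
| "wval q W (WRead a e) = W a (wval q W e)"
| "wval q W (WAdd e f) = (wval q W e + wval q W f) mod q"
| "wval q W (WSub e f) = (wval q W e - wval q W f) mod q"
| "wval q W (WMul e f) = (wval q W e * wval q W f) mod q"
| "wval q W (WDiv e f) = (wval q W e div wval q W f) mod q"
| "wval q W (WMod e f) = (wval q W e mod wval q W f) mod q"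

primrec rval :: "nat \<Rightarrow> words \<Rightarrow> reals \<Rightarrow> rexp \<Rightarrow> real" where
  "rval q W R (ROfWord e) = real (wval q W e)"
| "rval q W R (RRead a e) = R a (wval q W e)"
| "rval q W R (RAdd e f) = rval q W R e + rval q W R f"
| "rval q W R (RSub e f) = rval q W R e - rval q W R f"
| "rval q W R (RMul e f) = rval q W R e * rval q W R f"
| "rval q W R (RDiv e f) = rval q W R e / rval q W R f"

primrec holds :: "nat \<Rightarrow> words \<Rightarrow> reals \<Rightarrow> test \<Rightarrow> bool" where
  "holds q W R (WLess e f) \<longleftrightarrow> wval q W e < wval q W f"
| "holds q W R (RLess e f) \<longleftrightarrow> rval q W R e < rval q W R f"

primrec wcost :: "wexp \<Rightarrow> nat" where
  "wcost (WConst c) = 1"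
| "wcost (WRead a e) = wcost e + 1"
| "wcost (WAdd e f) = wcost e + wcost f + 1"
| "wcost (WSub e f) = wcost e + wcost f + 1"
| "wcost (WMul e f) = wcost e + wcost f + 1"
| "wcost (WDiv e f) = wcost e + wcost f + 1"
| "wcost (WMod e f) = wcost e + wcost f + 1"

primrec rcost :: "rexp \<Rightarrow> nat" where
  "rcost (ROfWord e) = wcost e + 1"
| "rcost (RRead a e) = wcost e + 1"
| "rcost (RAdd e f) = rcost e + rcost f + 1"
| "rcost (RSub e f) = rcost e + rcost f + 1"
| "rcost (RMul e f) = rcost e + rcost f + 1"
| "rcost (RDiv e f) = rcost e + rcost f + 1"

primrec tcost :: "test \<Rightarrow> nat" where
  "tcost (WLess e f) = wcost e + wcost f + 1"
| "tcost (RLess e f) = rcost e + rcost f + 1"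

text \<open>\<open>exec q A (W, R) t (W', R')\<close>: from memory \<open>(W, R)\<close>, \<open>A\<close> halts after \<open>t\<close> steps in \<open>(W', R')\<close>.\<close>

inductive exec :: "nat \<Rightarrow> prog \<Rightarrow> words \<times> reals \<Rightarrow> nat \<Rightarrow> words \<times> reals \<Rightarrow> bool" for q where
  exec_Skip: "exec q Skip s 1 s"
| exec_WWrite: "exec q (WWrite a e f) (W, R) (wcost e + wcost f + 1)
    (W(a := (W a)(wval q W e := wval q W f)), R)"
| exec_RWrite: "exec q (RWrite a e f) (W, R) (wcost e + rcost f + 1)
    (W, R(a := (R a)(wval q W e := rval q W R f)))"
| exec_Seq: "exec q A s t s' \<Longrightarrow> exec q B s' u s'' \<Longrightarrow> exec q (Seq A B) s (t + u) s''"
| exec_Cond_True: "holds q W R b \<Longrightarrow> exec q A (W, R) t s' \<Longrightarrow>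
    exec q (Cond b A B) (W, R) (tcost b + t) s'"
| exec_Cond_False: "\<not> holds q W R b \<Longrightarrow> exec q B (W, R) t s' \<Longrightarrow>
    exec q (Cond b A B) (W, R) (tcost b + t) s'"
| exec_Loop_False: "\<not> holds q W R b \<Longrightarrow> exec q (Loop b A) (W, R) (tcost b) (W, R)"
| exec_Loop_True: "holds q W R b \<Longrightarrow> exec q A (W, R) t s' \<Longrightarrow> exec q (Loop b A) s' u s'' \<Longrightarrow>
    exec q (Loop b A) (W, R) (tcost b + t + u) s''"

lemma exec_deterministic:
  assumes "exec q A s t s'" and "exec q A s u s''"
  shows "u = t \<and> s'' = s'"
  using assms
proof (induction arbitrary: u s'' rule: exec.induct)
  case (exec_Seq A s t s' B u s'')
  from exec_Seq.prems show ?case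
    by (cases rule: exec.cases) (use exec_Seq.IH in blast)+
next
  case (exec_Loop_True W R b A t s' u s'')
  from exec_Loop_True.prems show ?case
    by (cases rule: exec.cases) (use exec_Loop_True.IH exec_Loop_True.hyps in blast)+
qed (erule exec.cases; fastforce)+

text \<open>
  Input: \<open>n\<close> in cell 0 of word array 0; the representation \<open>d\<close> of the set \<open>S\<close> in word array 1;
  the vector \<open>x\<^sup>(\<^sup>k\<^sup>)\<close> in cells 1 to \<open>n\<close> of real array \<open>k\<close>. All other cells are 0.
\<close>

definition input_words :: "nat \<Rightarrow> nat list \<Rightarrow> words" where
  "input_words n d = (\<lambda>a j.
     if a = 0 \<and> j = 0 then n
     else if a = 1 \<and> j < length d then d ! j
     else 0)"

definition input_reals :: "nat \<Rightarrow> nat \<Rightarrow> (nat \<Rightarrow> nat \<Rightarrow> real) \<Rightarrow> reals" where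
  "input_reals n m x = (\<lambda>k j. if k \<in> {1..m} \<and> j \<in> {1..n} then x k j else 0)"

text \<open>
  The program \<open>A\<close> computes the sum over \<open>S\<close>, leaving it in cell 0 of real array 0, within time \<open>\<tau>\<close>
  for all vectors. The representation \<open>d\<close> is a list of words that depends on \<open>S\<close> only, not on the
  vectors; its length is charged to the running time.
\<close>

definition sums_within :: "nat \<Rightarrow> prog \<Rightarrow> nat \<Rightarrow> nat \<Rightarrow> (nat \<Rightarrow> nat) set \<Rightarrow> real \<Rightarrow> bool" where
  "sums_within q A m n S \<tau> \<longleftrightarrow>
     (\<exists>d. (\<forall>w\<in>set d. w < q) \<and>
       (\<forall>x. \<exists>t W R. exec q A (input_words n d, input_reals n m x) t (W, R) \<and>
          real (length d + t) \<le> \<tau> \<and> R 0 0 = product_sum m S x))"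

text \<open>
  Asymptotic running times refer to a family \<open>D n p\<close> of random subsets of \<open>[n]\<^sup>m\<close>. One program \<open>A\<close>
  and one time bound \<open>T\<close> serve all \<open>n\<close>, all \<open>p\<close> and all outcomes \<open>S\<close>, and \<open>T\<close> depends on \<open>n\<close> only.
\<close>

definition admits_summation_in ::
    "(nat \<Rightarrow> real) set \<Rightarrow> nat \<Rightarrow> (nat \<Rightarrow> real \<Rightarrow> (nat \<Rightarrow> nat) set pmf) \<Rightarrow> bool" where
  "admits_summation_in F m D \<longleftrightarrow>
     (\<exists>A b. \<exists>T\<in>F. \<forall>n\<ge>1. \<forall>p\<in>{0<..1}. \<forall>S\<in>set_pmf (D n p).
        sums_within ((n + 1) ^ b) A m n S (T n))"

definition soft_O :: "(nat \<Rightarrow> real) \<Rightarrow> (nat \<Rightarrow> real) set" where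
  "soft_O f = (\<Union>c::nat. O(\<lambda>n. f n * ln (f n) ^ c))"

definition admits_fast_summation ::
    "nat \<Rightarrow> (nat \<Rightarrow> real \<Rightarrow> (nat \<Rightarrow> nat) set pmf) \<Rightarrow> bool" where
  "admits_fast_summation m D \<longleftrightarrow> admits_summation_in (soft_O (\<lambda>n. real (m * n))) m D"

end

theory Submission
  imports Defs "HOL-Real_Asymp.Real_Asymp"
begin

text \<open>
  Fix a set \<open>T\<close> of \<open>m\<close>-tuples over \<open>{..<N}\<close>, draw independent uniform permutations
  \<open>h\<^sub>1, \<dots>, h\<^sub>m\<close> of \<open>{..<N}\<close> (\<open>N > n\<close>), and keep the grid points \<open>g\<close> with
  \<open>(h\<^sub>1 (g\<^sub>1), \<dots>, h\<^sub>m (g\<^sub>m)) \<in> T\<close>. Two grid points agreeing on the coordinates \<open>A\<close> are sent to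
  a uniform pair of tuples agreeing exactly on \<open>A\<close>, so the result is a \<open>p\<close>-sample as soon as \<open>T\<close>
  has density about \<open>p\<close> and no tuple of \<open>T\<close> has more than \<open>card T / N ^ card A\<close> neighbours in \<open>T\<close>
  agreeing with it exactly on \<open>A\<close>.

  For \<open>m = 2\<close> take the pairs lying in the same block of a partition into about \<open>1 / p\<close> blocks. For
  \<open>m = 3\<close> take the triples whose lowest \<open>b\<close> bits have bitwise xor 0; if \<open>p\<close> is below about \<open>1 / n\<close>,
  require in addition that the three remaining upper parts be equal. For \<open>p\<close> below about \<open>1 / n\<^sup>2\<close> the
  latter is used with \<open>b = 0\<close> and \<open>N\<close> of order \<open>p powr (-1/2)\<close>, which may far exceed \<open>n\<close>, but then the
  summation only depends on which values coincide. The trilinear form of the xor relation is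
  diagonalised by \<open>b\<close> rounds of the Walsh-Hadamard transform, which, unlike the Fourier transform,
  needs no irrational constants and therefore runs on the real RAM in \<open>O(n log n)\<close> steps.
\<close>

subsection \<open>Hoare triples with running times\<close>

text \<open>Total correctness with an upper bound on the time. A bound rather than the exact cost
  lets all rounds of a loop be charged uniformly.\<close>

definition triple :: "nat \<Rightarrow> (words \<Rightarrow> reals \<Rightarrow> bool) \<Rightarrow> prog \<Rightarrow> nat \<Rightarrow> (words \<Rightarrow> reals \<Rightarrow> bool) \<Rightarrow> bool" where
  "triple q P A \<tau> Q \<longleftrightarrow>
     (\<forall>W R. P W R \<longrightarrow> (\<exists>t W' R'. exec q A (W, R) t (W', R') \<and> t \<le> \<tau> \<and> Q W' R'))"

lemma triple_conseq:
  assumes "triple q P A \<tau> Q"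
    and "\<And>W R. P' W R \<Longrightarrow> P W R" and "\<And>W R. Q W R \<Longrightarrow> Q' W R" and "\<tau> \<le> \<tau>'"
  shows "triple q P' A \<tau>' Q'"
  using assms unfolding triple_def by (meson order_trans)

text \<open>For rules whose postcondition mentions the initial reals \<open>R\<^sub>0\<close>: the
  start memory is frozen first, and the rule is then instantiated with it.\<close>

lemma triple_fix_memory:
  assumes "\<And>W\<^sub>0 R\<^sub>0. P W\<^sub>0 R\<^sub>0 \<Longrightarrow> triple q (\<lambda>W R. W = W\<^sub>0 \<and> R = R\<^sub>0) A \<tau> Q"
  shows "triple q P A \<tau> Q"
  using assms unfolding triple_def by blast

lemma triple_Skip:
  "triple q P Skip 1 P"
  unfolding triple_def by (meson exec_Skip order_refl)

lemma triple_RWrite: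
  assumes "\<And>W R. P W R \<Longrightarrow> Q W (R(a := (R a)(wval q W e := rval q W R f)))"
  shows "triple q P (RWrite a e f) (wcost e + rcost f + 1) Q"
  unfolding triple_def by (meson assms exec_RWrite order_refl)

lemma triple_WWrite:
  assumes "\<And>W R. P W R \<Longrightarrow> Q (W(a := (W a)(wval q W e := wval q W f))) R"
  shows "triple q P (WWrite a e f) (wcost e + wcost f + 1) Q"
  unfolding triple_def by (meson assms exec_WWrite order_refl)

lemma triple_Seq:
  assumes "triple q P A \<tau> Q" and "triple q Q B \<upsilon> S"
  shows "triple q P (Seq A B) (\<tau> + \<upsilon>) S"
  unfolding triple_def
proof (intro allI impI)
  fix W R assume "P W R"
  then obtain t W' R' where 1: "exec q A (W, R) t (W', R')" "t \<le> \<tau>" "Q W' R'"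
    using assms(1) unfolding triple_def by blast
  then obtain u W'' R'' where 2: "exec q B (W', R') u (W'', R'')" "u \<le> \<upsilon>" "S W'' R''"
    using assms(2) unfolding triple_def by blast
  show "\<exists>t W' R'. exec q (Seq A B) (W, R) t (W', R') \<and> t \<le> \<tau> + \<upsilon> \<and> S W' R'"
    using exec_Seq[OF 1(1) 2(1)] 1(2) 2(2,3) add_mono by blast
qed

definition for_up :: "nat \<Rightarrow> wexp \<Rightarrow> prog \<Rightarrow> prog" where
  "for_up c e A = Seq (WWrite c (WConst 0) (WConst 0))
     (Loop (WLess (WRead c (WConst 0)) e)
       (Seq A (WWrite c (WConst 0) (WAdd (WRead c (WConst 0)) (WConst 1)))))"

text \<open>The counter lives in cell 0 of word array \<open>c\<close>: the invariant has to survive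
  any write to it (\<open>frame\<close>), the body has to hand it back unchanged, and
  \<open>k < q\<close> keeps the increment from wrapping around. A round costs \<open>\<tau>\<close>
  for the body, 6 for the increment and \<open>wcost e + 3\<close> for the test; the extra round in
  \<open>k + 1\<close> pays for the initialisation and the failing last test.\<close>

lemma triple_for_up:
  assumes frame: "\<And>j W R v. I j W R \<Longrightarrow> I j (W(c := (W c)(0 := v))) R"
    and bound: "\<And>j W R. I j W R \<Longrightarrow> wval q W e = k"
    and q: "k < q" "1 < q"
    and body: "\<And>j. j < k \<Longrightarrow>
      triple q (\<lambda>W R. I j W R \<and> W c 0 = j) A \<tau> (\<lambda>W R. I (Suc j) W R \<and> W c 0 = j)"
  shows "triple q (I 0) (for_up c e A) ((k + 1) * (\<tau> + wcost e + 9)) (I k)"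
proof -
  let ?A = "Seq A (WWrite c (WConst 0) (WAdd (WRead c (WConst 0)) (WConst 1)))"
  let ?b = "WLess (WRead c (WConst 0)) e"
  have step: "triple q (\<lambda>W R. I j W R \<and> W c 0 = j) ?A (\<tau> + 6)
      (\<lambda>W R. I (Suc j) W R \<and> W c 0 = Suc j)" if "j < k" for j
  proof (rule triple_conseq[OF triple_Seq[OF body[OF that] triple_WWrite]])
    show "\<And>W R. I (Suc j) W R \<and> W c 0 = j \<Longrightarrow>
        I (Suc j) (W(c := (W c)(wval q W (WConst 0) :=
          wval q W (WAdd (WRead c (WConst 0)) (WConst 1))))) R \<and>
        (W(c := (W c)(wval q W (WConst 0) :=
          wval q W (WAdd (WRead c (WConst 0)) (WConst 1))))) c 0 = Suc j"
      using that q frame by (simp add: mod_less)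
  qed auto
  \<comment> \<open>Induction on the number \<open>i\<close> of rounds still to come.\<close>
  have loop: "triple q (\<lambda>W R. I j W R \<and> W c 0 = j) (Loop ?b ?A)
      (i * (\<tau> + wcost e + 9) + wcost e + 3) (I k)" if "j + i = k" for i j
    using that
  proof (induction i arbitrary: j)
    case 0
    have "exec q (Loop ?b ?A) (W, R) (tcost ?b) (W, R)" if "I k W R" "W c 0 = k" for W R
      by (rule exec_Loop_False) (use bound[OF that(1)] that in simp)
    then show ?case
      unfolding triple_def using 0 by fastforce
  next
    case (Suc i)
    show ?case
      unfolding triple_def
    proof (intro allI impI)
      fix W R assume W: "I j W R \<and> W c 0 = j"
      have "j < k" using Suc.prems by simp
      have holds: "holds q W R ?b"
        using bound[of j W R] W Suc.prems by simp
      obtain t W' R' where 1: "exec q ?A (W, R) t (W', R')" "t \<le> \<tau> + 6"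
          "I (Suc j) W' R' \<and> W' c 0 = Suc j"
        using step[OF \<open>j < k\<close>] W unfolding triple_def by blast
      obtain u W'' R'' where 2: "exec q (Loop ?b ?A) (W', R') u (W'', R'')"
          "u \<le> i * (\<tau> + wcost e + 9) + wcost e + 3" "I k W'' R''"
        using Suc.IH[of "Suc j"] Suc.prems 1(3) unfolding triple_def by (metis add_Suc add_Suc_right)
      have "tcost ?b + t + u \<le> Suc i * (\<tau> + wcost e + 9) + wcost e + 3"
        using 1(2) 2(2) by simp
      then show "\<exists>t W' R'. exec q (Loop ?b ?A) (W, R) t (W', R') \<and>
          t \<le> Suc i * (\<tau> + wcost e + 9) + wcost e + 3 \<and> I k W' R'"
        using exec_Loop_True[OF holds 1(1) 2(1)] 2(3) by blast
    qed
  qed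
  have init: "triple q (I 0) (WWrite c (WConst 0) (WConst 0)) 3 (\<lambda>W R. I 0 W R \<and> W c 0 = 0)"
  proof (rule triple_conseq[OF triple_WWrite])
    show "\<And>W R. I 0 W R \<Longrightarrow> I 0 (W(c := (W c)(wval q W (WConst 0) := wval q W (WConst 0)))) R \<and>
        (W(c := (W c)(wval q W (WConst 0) := wval q W (WConst 0)))) c 0 = 0"
      using q frame by simp
  qed auto
  show ?thesis
    unfolding for_up_def
    by (rule triple_conseq[OF triple_Seq[OF init loop[of 0 k]]]) auto
qed

subsection \<open>The summation program\<close>

text \<open>The part of the input words that the program relies on. The counters are kept in word
  arrays 2 and 3, so every write of the program preserves it.\<close>

definition loaded :: "nat \<Rightarrow> nat list \<Rightarrow> words \<Rightarrow> bool" where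
  "loaded n d W \<longleftrightarrow> W 0 0 = n \<and> (\<forall>j<length d. W 1 j = d ! j)"

lemma loaded_upd [simp]: "loaded n d W \<Longrightarrow> 1 < a \<Longrightarrow> loaded n d (W(a := f))"
  by (auto simp: loaded_def)

abbreviation counter :: wexp where "counter \<equiv> WRead 2 (WConst 0)"
abbreviation size_word :: wexp where "size_word \<equiv> WRead 1 (WConst 0)"
abbreviation rounds_word :: wexp where "rounds_word \<equiv> WRead 1 (WConst 1)"

text \<open>
  The representation of \<open>S\<close> holds the number of cells at index 0, the number \<open>b\<close> of transform rounds at
  index 1 and, at index \<open>i * m + (r - 1)\<close> with \<open>1 \<le> i\<close>, the cell to which \<open>x r i\<close> is added.
\<close>

definition address :: "nat \<Rightarrow> nat \<Rightarrow> wexp" where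
  "address m r = WRead 1 (WAdd (WMul counter (WConst m)) (WConst (r - 1)))"

text \<open>The loop also visits \<open>i = 0\<close>, which is harmless because cell 0 of every input vector is 0.\<close>

definition scatter :: "nat \<Rightarrow> nat \<Rightarrow> prog" where
  "scatter m r = for_up 2 (WAdd (WRead 0 (WConst 0)) (WConst 1))
     (RWrite (m + r) (address m r) (RAdd (RRead (m + r) (address m r)) (RRead r counter)))"

abbreviation half_word :: wexp where "half_word \<equiv> WDiv size_word (WConst 2)"
abbreviation even_word :: wexp where "even_word \<equiv> WMul (WConst 2) counter"
abbreviation odd_word :: wexp where "odd_word \<equiv> WAdd even_word (WConst 1)"

text \<open>
  Constant-geometry butterflies: since every round halves the cell index and moves the transformed bit
  to the top, all rounds execute the same code.
\<close>

definition butterfly :: "nat \<Rightarrow> nat \<Rightarrow> prog" where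
  "butterfly m r = Seq
     (for_up 2 half_word (Seq
        (RWrite (2 * m + 1) counter (RAdd (RRead (m + r) even_word) (RRead (m + r) odd_word)))
        (RWrite (2 * m + 1) (WAdd counter half_word)
          (RSub (RRead (m + r) even_word) (RRead (m + r) odd_word)))))
     (for_up 2 size_word (RWrite (m + r) counter (RRead (2 * m + 1) counter)))"

definition hadamard :: "nat \<Rightarrow> nat \<Rightarrow> prog" where
  "hadamard m r = for_up 3 rounds_word (butterfly m r)"

text \<open>Since \<open>m\<close> is a literal of the program, the product is unrolled into one
  expression of cost linear in \<open>m\<close> instead of a loop.\<close>

primrec product_exp :: "nat \<Rightarrow> nat \<Rightarrow> rexp" where
  "product_exp m 0 = ROfWord (WConst 1)"
| "product_exp m (Suc r) = RMul (product_exp m r) (RRead (m + Suc r) counter)"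

text \<open>The second loop divides by \<open>2 ^ b\<close>, the normalisation that
  \<open>trilinear_xor_rel\<close> demands after \<open>b\<close> transform rounds.\<close>

definition collect :: "nat \<Rightarrow> prog" where
  "collect m = Seq
     (for_up 2 size_word (RWrite 0 (WConst 0) (RAdd (RRead 0 (WConst 0)) (product_exp m m))))
     (for_up 3 rounds_word (RWrite 0 (WConst 0) (RDiv (RRead 0 (WConst 0)) (ROfWord (WConst 2)))))"

primrec transforms :: "nat \<Rightarrow> nat \<Rightarrow> prog" where
  "transforms m 0 = Skip"
| "transforms m (Suc r) = Seq (transforms m r) (Seq (scatter m (Suc r)) (hadamard m (Suc r)))"

definition summation :: "nat \<Rightarrow> prog" where
  "summation m = Seq (transforms m m) (collect m)"

section \<open>Correctness and running time of the summation program\<close>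

definition bfly :: "nat \<Rightarrow> (nat \<Rightarrow> real) \<Rightarrow> nat \<Rightarrow> real" where
  "bfly H f u = (if u < H then f (2 * u) + f (2 * u + 1) else f (2 * (u - H)) - f (2 * (u - H) + 1))"

lemma bfly_cong:
  assumes "\<And>u. u < 2 * H \<Longrightarrow> f u = g u" and "u < 2 * H"
  shows "bfly H f u = bfly H g u"
  using assms(2) by (auto simp: bfly_def intro!: arg_cong2[where f = "(+)"] arg_cong2[where f = "(-)"] assms(1))

definition bucket_sum :: "nat \<Rightarrow> (nat \<Rightarrow> nat) \<Rightarrow> (nat \<Rightarrow> real) \<Rightarrow> nat \<Rightarrow> real" where
  "bucket_sum n a x u = (\<Sum>i<n. if a i = u then x i else 0)"

lemma triple_scatter:
  assumes len: "length d = m * (n + 1)" and q: "m * (n + 2) < q" "1 < q" "n + 1 < q" "m < q"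
    and r: "r \<in> {1..m}"
  shows "triple q (\<lambda>W R. loaded n d W \<and> R = R\<^sub>0) (scatter m r) ((n + 2) * 50)
    (\<lambda>W R. loaded n d W \<and> (\<forall>a. a \<noteq> m + r \<longrightarrow> R a = R\<^sub>0 a) \<and>
      (\<forall>u. R (m + r) u = R\<^sub>0 (m + r) u + bucket_sum (n + 1) (\<lambda>i. d ! (i * m + (r - 1))) (R\<^sub>0 r) u))"
proof -
  let ?a = "\<lambda>i. d ! (i * m + (r - 1))"
  define I where "I j W R \<longleftrightarrow> loaded n d W \<and> (\<forall>a. a \<noteq> m + r \<longrightarrow> R a = R\<^sub>0 a) \<and>
      (\<forall>u. R (m + r) u = R\<^sub>0 (m + r) u + bucket_sum j ?a (R\<^sub>0 r) u)" for j W R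
  \<comment> \<open>Row \<open>j\<close> ends inside \<open>d\<close> and
    \<open>length d < q\<close>, so nothing in the address computation wraps around modulo
    \<open>q\<close>.\<close>
  have addr: "wval q W (address m r) = ?a j" if "I j W R" "W 2 0 = j" "j < n + 1" for j W R
  proof -
    have "j * m + (r - 1) < (j + 1) * m" using r by auto
    also have "\<dots> \<le> (n + 1) * m" using that by (intro mult_right_mono) auto
    finally have 1: "j * m + (r - 1) < length d" using len by (simp add: mult.commute)
    then have "j * m + (r - 1) < q" using q len by (simp add: algebra_simps)
    moreover from this have "j * m < q" "r - 1 < q" by auto
    ultimately show ?thesis
      using that 1 q by (simp add: address_def I_def loaded_def)
  qed
  have "triple q (I 0) (scatter m r) ((n + 1 + 1) * (23 + wcost (WAdd (WRead 0 (WConst 0)) (WConst 1)) + 9)) (I (n + 1))"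
    unfolding scatter_def
  proof (rule triple_for_up)
    fix j assume j: "j < n + 1"
    show "triple q (\<lambda>W R. I j W R \<and> W 2 0 = j)
        (RWrite (m + r) (address m r) (RAdd (RRead (m + r) (address m r)) (RRead r counter))) 23
        (\<lambda>W R. I (Suc j) W R \<and> W 2 0 = j)"
    proof (rule triple_conseq[OF triple_RWrite[where P = "\<lambda>W R. I j W R \<and> W 2 0 = j" and Q = "\<lambda>W R. I (Suc j) W R \<and> W 2 0 = j"]])
      fix W R assume W: "I j W R \<and> W 2 0 = j"
      have "R r = R\<^sub>0 r" using W r by (auto simp: I_def)
      then show "I (Suc j) W (R(m + r := (R (m + r))(wval q W (address m r) :=
          rval q W R (RAdd (RRead (m + r) (address m r)) (RRead r counter))))) \<and> W 2 0 = j"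
        using W addr[of j W R] j q(2) by (auto simp: I_def bucket_sum_def)
    qed (auto simp: address_def)
  qed (use q in \<open>auto simp: I_def loaded_def\<close>)
  then show ?thesis
    by (rule triple_conseq) (auto simp: I_def bucket_sum_def)
qed

text \<open>The results pass through the scratch array \<open>2 * m + 1\<close>, because writing
  cell \<open>j + H\<close> in place would destroy an entry whose own pair is read only later. The
  value \<open>s\<close> is the counter of the surrounding loop in \<open>hadamard\<close>, which
  has to survive the pass.\<close>

lemma triple_butterfly:
  assumes d: "d ! 0 = 2 * H" "0 < length d" and q: "2 * H + 1 < q" "2 < q"
    and r: "r \<in> {1..m}"
  shows "triple q (\<lambda>W R. loaded n d W \<and> W 3 0 = s \<and> R = R\<^sub>0) (butterfly m r) ((2 * H + 1) * 100)
    (\<lambda>W R. loaded n d W \<and> W 3 0 = s \<and> (\<forall>a. a \<noteq> m + r \<and> a \<noteq> 2 * m + 1 \<longrightarrow> R a = R\<^sub>0 a) \<and>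
      (\<forall>u<2 * H. R (m + r) u = bfly H (R\<^sub>0 (m + r)) u))"
proof -
  have sz: "wval q W size_word = 2 * H" "wval q W half_word = H" if "loaded n d W" for W
    using that d q by (auto simp: loaded_def)
  define I where "I j W R \<longleftrightarrow> loaded n d W \<and> W 3 0 = s \<and> (\<forall>a. a \<noteq> 2 * m + 1 \<longrightarrow> R a = R\<^sub>0 a) \<and>
      (\<forall>u<j. R (2 * m + 1) u = bfly H (R\<^sub>0 (m + r)) u \<and>
         R (2 * m + 1) (u + H) = bfly H (R\<^sub>0 (m + r)) (u + H))" for j W R
  define J where "J j W R \<longleftrightarrow> loaded n d W \<and> W 3 0 = s \<and> (\<forall>a. a \<noteq> m + r \<and> a \<noteq> 2 * m + 1 \<longrightarrow> R a = R\<^sub>0 a) \<and>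
      (\<forall>u<2 * H. R (2 * m + 1) u = bfly H (R\<^sub>0 (m + r)) u) \<and>
      (\<forall>u<j. R (m + r) u = bfly H (R\<^sub>0 (m + r)) u)" for j W R
  have mr: "m + r \<noteq> 2 * m + 1" using r by auto
  let ?A1 = "RWrite (2 * m + 1) counter (RAdd (RRead (m + r) even_word) (RRead (m + r) odd_word))"
  let ?A2 = "RWrite (2 * m + 1) (WAdd counter half_word)
          (RSub (RRead (m + r) even_word) (RRead (m + r) odd_word))"
  have body: "triple q (\<lambda>W R. I j W R \<and> W 2 0 = j) (Seq ?A1 ?A2) (17 + 21)
      (\<lambda>W R. I (Suc j) W R \<and> W 2 0 = j)" if j: "j < H" for j
  proof (rule triple_Seq)
    show "triple q (\<lambda>W R. I j W R \<and> W 2 0 = j) ?A1 17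
        (\<lambda>W R. I j W R \<and> W 2 0 = j \<and> R (2 * m + 1) j = bfly H (R\<^sub>0 (m + r)) j)"
      by (rule triple_conseq[OF triple_RWrite[where P = "\<lambda>W R. I j W R \<and> W 2 0 = j"
            and Q = "\<lambda>W R. I j W R \<and> W 2 0 = j \<and> R (2 * m + 1) j = bfly H (R\<^sub>0 (m + r)) j"]])
        (use j q mr in \<open>auto simp: I_def bfly_def\<close>)
    show "triple q (\<lambda>W R. I j W R \<and> W 2 0 = j \<and> R (2 * m + 1) j = bfly H (R\<^sub>0 (m + r)) j)
        ?A2 21 (\<lambda>W R. I (Suc j) W R \<and> W 2 0 = j)"
    proof (rule triple_conseq[OF triple_RWrite[where Q = "\<lambda>W R. I (Suc j) W R \<and> W 2 0 = j"
            and P = "\<lambda>W R. I j W R \<and> W 2 0 = j \<and> R (2 * m + 1) j = bfly H (R\<^sub>0 (m + r)) j"]])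
      fix W R assume W: "I j W R \<and> W 2 0 = j \<and> R (2 * m + 1) j = bfly H (R\<^sub>0 (m + r)) j"
      then have h: "wval q W (WAdd counter half_word) = j + H"
        using sz(2)[of W] q j by (simp add: I_def del: wval.simps(6))
      have v: "rval q W R (RSub (RRead (m + r) even_word) (RRead (m + r) odd_word)) =
          bfly H (R\<^sub>0 (m + r)) (j + H)"
        using W q j mr by (simp add: I_def bfly_def)
      show "I (Suc j) W (R(2 * m + 1 := (R (2 * m + 1))(wval q W (WAdd counter half_word) :=
          rval q W R (RSub (RRead (m + r) even_word) (RRead (m + r) odd_word))))) \<and> W 2 0 = j"
        unfolding h v using W j by (auto simp: I_def less_Suc_eq)
    qed auto
  qed
  have 1: "triple q (I 0) (for_up 2 half_word (Seq ?A1 ?A2)) ((H + 1) * (17 + 21 + wcost half_word + 9)) (I H)"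
  proof (rule triple_for_up)
    show "I j (W(2 := (W 2)(0 := v))) R" if "I j W R" for j W R v
      using that by (simp add: I_def)
  qed (use body q sz in \<open>auto simp: I_def simp del: wval.simps\<close>)
  have 2: "triple q (J 0) (for_up 2 size_word (RWrite (m + r) counter (RRead (2 * m + 1) counter)))
      ((2 * H + 1) * (6 + wcost size_word + 9)) (J (2 * H))"
  proof (rule triple_for_up)
    show "J j (W(2 := (W 2)(0 := v))) R" if "J j W R" for j W R v
      using that by (simp add: J_def)
  next
    fix j assume j: "j < 2 * H"
    show "triple q (\<lambda>W R. J j W R \<and> W 2 0 = j) (RWrite (m + r) counter (RRead (2 * m + 1) counter)) 6
        (\<lambda>W R. J (Suc j) W R \<and> W 2 0 = j)"
      by (rule triple_conseq[OF triple_RWrite[where P = "\<lambda>W R. J j W R \<and> W 2 0 = j"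
            and Q = "\<lambda>W R. J (Suc j) W R \<and> W 2 0 = j"]])
        (use j q mr in \<open>auto simp: J_def less_Suc_eq\<close>)
  qed (use q sz in \<open>auto simp: J_def simp del: wval.simps\<close>)
  \<comment> \<open>The first loop fills the cells \<open>u\<close> and \<open>u + H\<close> in the
    same round, so for cells from \<open>H\<close> on its invariant is used at
    \<open>u - H\<close>.\<close>
  have IJ: "J 0 W R" if "I H W R" for W R
    unfolding J_def
  proof (intro conjI allI impI)
    fix u assume u: "u < 2 * H"
    have *: "\<forall>u<H. R (2 * m + 1) u = bfly H (R\<^sub>0 (m + r)) u \<and>
         R (2 * m + 1) (u + H) = bfly H (R\<^sub>0 (m + r)) (u + H)"
      using that unfolding I_def by blast
    show "R (2 * m + 1) u = bfly H (R\<^sub>0 (m + r)) u"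
    proof (cases "u < H")
      case False
      then have "u - H < H" "u - H + H = u" using u by auto
      then show ?thesis using * by metis
    qed (use * in blast)
  qed (use that in \<open>auto simp: I_def\<close>)
  show ?thesis
    unfolding butterfly_def
    by (rule triple_conseq[OF triple_Seq[OF 1 triple_conseq[OF 2 IJ]]]) (auto simp: I_def J_def)
qed

text \<open>Parity of \<open>M\<close> is tied to \<open>b > 0\<close> because patterns without
  transform rounds are run with \<open>n + 1\<close> cells, which may be odd.\<close>

lemma triple_hadamard:
  assumes d: "d ! 0 = M" "d ! 1 = b" "1 < length d" "b > 0 \<Longrightarrow> even M" and q: "M + 1 < q" "2 < q" "b < q"
    and r: "r \<in> {1..m}"
  shows "triple q (\<lambda>W R. loaded n d W \<and> R = R\<^sub>0) (hadamard m r) ((b + 1) * ((M + 1) * 100 + 11))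
    (\<lambda>W R. loaded n d W \<and> (\<forall>a. a \<noteq> m + r \<and> a \<noteq> 2 * m + 1 \<longrightarrow> R a = R\<^sub>0 a) \<and>
      (\<forall>u<M. R (m + r) u = (bfly (M div 2) ^^ b) (R\<^sub>0 (m + r)) u))"
proof -
  define I where "I j W R \<longleftrightarrow> loaded n d W \<and> (\<forall>a. a \<noteq> m + r \<and> a \<noteq> 2 * m + 1 \<longrightarrow> R a = R\<^sub>0 a) \<and>
      (\<forall>u<M. R (m + r) u = (bfly (M div 2) ^^ j) (R\<^sub>0 (m + r)) u)" for j W R
  have rounds: "wval q W rounds_word = b" if "loaded n d W" for W
    using that d q by (auto simp: loaded_def)
  have "triple q (I 0) (for_up 3 rounds_word (butterfly m r))
      ((b + 1) * ((M + 1) * 100 + wcost rounds_word + 9)) (I b)"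
  proof (rule triple_for_up)
    show "I j (W(3 := (W 3)(0 := v))) R" if "I j W R" for j W R v
      using that by (simp add: I_def)
  next
    fix j assume "j < b"
    then have M: "2 * (M div 2) = M" using d(4) by auto
    show "triple q (\<lambda>W R. I j W R \<and> W 3 0 = j) (butterfly m r) ((M + 1) * 100)
        (\<lambda>W R. I (Suc j) W R \<and> W 3 0 = j)"
    proof (rule triple_fix_memory)
      fix W\<^sub>1 R\<^sub>1 assume W: "I j W\<^sub>1 R\<^sub>1 \<and> W\<^sub>1 3 0 = j"
      \<comment> \<open>The invariant fixes only the cells below \<open>M\<close>, and a round reads
        no others.\<close>
      have "bfly (M div 2) (R\<^sub>1 (m + r)) u = bfly (M div 2) ((bfly (M div 2) ^^ j) (R\<^sub>0 (m + r))) u"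
        if "u < M" for u
        using W that by (intro bfly_cong) (auto simp: I_def M)
      then show "triple q (\<lambda>W R. W = W\<^sub>1 \<and> R = R\<^sub>1) (butterfly m r) ((M + 1) * 100)
          (\<lambda>W R. I (Suc j) W R \<and> W 3 0 = j)"
        by (intro triple_conseq[OF triple_butterfly[where H = "M div 2" and d = d and n = n and s = j and R\<^sub>0 = R\<^sub>1]])
          (use W d q r in \<open>auto simp: I_def M\<close>)
    qed
  qed (use rounds q in \<open>auto simp: I_def simp del: wval.simps\<close>)
  then show ?thesis
    unfolding hadamard_def by (rule triple_conseq) (auto simp: I_def)
qed

text \<open>Besides the finished transforms, the invariant keeps the later accumulators at zero,
  because \<open>scatter\<close> adds to what it finds, and it keeps the arrays up to
  \<open>m\<close>, which hold the vectors and the result cell.\<close>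

lemma triple_transforms:
  fixes d :: "nat list" and n m :: nat and x :: reals
  assumes d: "d ! 0 = M" "d ! 1 = b" "b > 0 \<Longrightarrow> even M" "length d = m * (n + 1)" "1 < length d"
    and q: "M + 1 < q" "2 < q" "b < q" "m * (n + 2) < q" "n + 1 < q" "m < q"
    and "r \<le> m"
  defines "G \<equiv> \<lambda>r. (bfly (M div 2) ^^ b) (bucket_sum (n + 1) (\<lambda>i. d ! (i * m + (r - 1))) (x r))"
  shows "triple q (\<lambda>W R. loaded n d W \<and> (\<forall>a\<le>m. R a = x a) \<and> (\<forall>i\<in>{1..m}. R (m + i) = (\<lambda>_. 0)))
    (transforms m r) (r * ((n + 2) * 50 + (b + 1) * ((M + 1) * 100 + 11)) + 1)
    (\<lambda>W R. loaded n d W \<and> (\<forall>a\<le>m. R a = x a) \<and>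
      (\<forall>i\<in>{1..r}. \<forall>u<M. R (m + i) u = G i u) \<and> (\<forall>i\<in>{r + 1..m}. R (m + i) = (\<lambda>_. 0)))"
  using \<open>r \<le> m\<close>
proof (induction r)
  case 0
  show ?case
    unfolding transforms.simps by (rule triple_conseq[OF triple_Skip], assumption) auto
next
  case (Suc r)
  let ?Q = "\<lambda>r W R. loaded n d W \<and> (\<forall>a\<le>m. R a = x a) \<and>
      (\<forall>i\<in>{1..r}. \<forall>u<M. R (m + i) u = G i u) \<and> (\<forall>i\<in>{r + 1..m}. R (m + i) = (\<lambda>_. 0))"
  let ?B = "bucket_sum (n + 1) (\<lambda>i. d ! (i * m + (Suc r - 1))) (x (Suc r))"
  have 1: "triple q (?Q r) (scatter m (Suc r)) ((n + 2) * 50)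
      (\<lambda>W R. loaded n d W \<and> (\<forall>a\<le>m. R a = x a) \<and> (\<forall>i\<in>{1..r}. \<forall>u<M. R (m + i) u = G i u) \<and>
        R (m + Suc r) = ?B \<and> (\<forall>i\<in>{Suc r + 1..m}. R (m + i) = (\<lambda>_. 0)))"
  proof (rule triple_fix_memory)
    fix W\<^sub>1 R\<^sub>1 assume W: "?Q r W\<^sub>1 R\<^sub>1"
    moreover have "Suc r \<in> {r + 1..m}" using Suc.prems by auto
    ultimately have "R\<^sub>1 (m + Suc r) = (\<lambda>_. 0)" by blast
    with W show "triple q (\<lambda>W R. W = W\<^sub>1 \<and> R = R\<^sub>1) (scatter m (Suc r)) ((n + 2) * 50)
      (\<lambda>W R. loaded n d W \<and> (\<forall>a\<le>m. R a = x a) \<and> (\<forall>i\<in>{1..r}. \<forall>u<M. R (m + i) u = G i u) \<and>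
        R (m + Suc r) = ?B \<and> (\<forall>i\<in>{Suc r + 1..m}. R (m + i) = (\<lambda>_. 0)))"
      by (intro triple_conseq[OF triple_scatter[where d = d and n = n and R\<^sub>0 = R\<^sub>1]])
        (use d q Suc.prems in \<open>auto intro!: ext\<close>)
  qed
  have 2: "triple q (\<lambda>W R. loaded n d W \<and> (\<forall>a\<le>m. R a = x a) \<and> (\<forall>i\<in>{1..r}. \<forall>u<M. R (m + i) u = G i u) \<and>
        R (m + Suc r) = ?B \<and> (\<forall>i\<in>{Suc r + 1..m}. R (m + i) = (\<lambda>_. 0)))
      (hadamard m (Suc r)) ((b + 1) * ((M + 1) * 100 + 11)) (?Q (Suc r))"
  proof (rule triple_fix_memory)
    fix W\<^sub>1 R\<^sub>1 assume W: "loaded n d W\<^sub>1 \<and> (\<forall>a\<le>m. R\<^sub>1 a = x a) \<and>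
        (\<forall>i\<in>{1..r}. \<forall>u<M. R\<^sub>1 (m + i) u = G i u) \<and>
        R\<^sub>1 (m + Suc r) = ?B \<and> (\<forall>i\<in>{Suc r + 1..m}. R\<^sub>1 (m + i) = (\<lambda>_. 0))"
    then have G: "G (Suc r) = (bfly (M div 2) ^^ b) (R\<^sub>1 (m + Suc r))"
      by (simp add: G_def)
    show "triple q (\<lambda>W R. W = W\<^sub>1 \<and> R = R\<^sub>1) (hadamard m (Suc r)) ((b + 1) * ((M + 1) * 100 + 11)) (?Q (Suc r))"
    proof (rule triple_conseq[OF triple_hadamard[where d = d and n = n and R\<^sub>0 = R\<^sub>1 and b = b and M = M and r = "Suc r" and m = m]])
      fix W R assume "loaded n d W \<and> (\<forall>a. a \<noteq> m + Suc r \<and> a \<noteq> 2 * m + 1 \<longrightarrow> R a = R\<^sub>1 a) \<and>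
        (\<forall>u<M. R (m + Suc r) u = (bfly (M div 2) ^^ b) (R\<^sub>1 (m + Suc r)) u)"
      then show "?Q (Suc r) W R"
        unfolding G[symmetric] using W Suc.prems by (auto simp: le_Suc_eq)
    qed (use W d q Suc.prems in auto)
  qed
  show ?case
    unfolding transforms.simps
    by (rule triple_conseq[OF triple_Seq[OF Suc.IH triple_Seq[OF 1 2]]]) (use Suc.prems in auto)
qed

lemma rcost_product_exp: "rcost (product_exp m r) = 4 * r + 2"
  by (induction r) auto

lemma rval_product_exp:
  assumes "1 < q"
  shows "rval q W R (product_exp m r) = (\<Prod>i\<in>{1..r}. R (m + i) (W 2 0))"
  using assms by (induction r) auto

lemma triple_collect:
  assumes d: "d ! 0 = M" "d ! 1 = b" "1 < length d" and q: "M + 1 < q" "2 < q" "b < q" and "0 < m"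
  shows "triple q (\<lambda>W R. loaded n d W \<and> R 0 0 = 0 \<and> (\<forall>i\<in>{1..m}. \<forall>u<M. R (m + i) u = G i u))
    (collect m) ((M + 1) * (4 * m + 50) + (b + 1) * 50)
    (\<lambda>W R. R 0 0 = (\<Sum>u<M. \<Prod>i\<in>{1..m}. G i u) / 2 ^ b)"
proof -
  define I where "I j W R \<longleftrightarrow> loaded n d W \<and> (\<forall>i\<in>{1..m}. \<forall>u<M. R (m + i) u = G i u) \<and>
      R 0 0 = (\<Sum>u<j. \<Prod>i\<in>{1..m}. G i u)" for j and W :: words and R :: reals
  define J where "J j W R \<longleftrightarrow> loaded n d W \<and> R 0 0 = (\<Sum>u<M. \<Prod>i\<in>{1..m}. G i u) / 2 ^ j"
    for j and W :: words and R :: reals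
  have 1: "triple q (I 0) (for_up 2 size_word (RWrite 0 (WConst 0) (RAdd (RRead 0 (WConst 0)) (product_exp m m))))
      ((M + 1) * ((4 * m + 7) + wcost size_word + 9)) (I M)"
  proof (rule triple_for_up)
    show "I j (W(2 := (W 2)(0 := v))) R" if "I j W R" for j W R v
      using that by (simp add: I_def)
  next
    fix j assume "j < M"
    then show "triple q (\<lambda>W R. I j W R \<and> W 2 0 = j)
        (RWrite 0 (WConst 0) (RAdd (RRead 0 (WConst 0)) (product_exp m m))) (4 * m + 7)
        (\<lambda>W R. I (Suc j) W R \<and> W 2 0 = j)"
      by (intro triple_conseq[OF triple_RWrite[where P = "\<lambda>W R. I j W R \<and> W 2 0 = j"
            and Q = "\<lambda>W R. I (Suc j) W R \<and> W 2 0 = j"]])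
        (use \<open>0 < m\<close> q in \<open>auto simp: I_def rcost_product_exp rval_product_exp\<close>)
  qed (use d q Suc_lessD[of 0 "length d"] in \<open>auto simp: I_def loaded_def\<close>)
  have 2: "triple q (J 0) (for_up 3 rounds_word (RWrite 0 (WConst 0) (RDiv (RRead 0 (WConst 0)) (ROfWord (WConst 2)))))
      ((b + 1) * (7 + wcost rounds_word + 9)) (J b)"
  proof (rule triple_for_up)
    show "J j (W(3 := (W 3)(0 := v))) R" if "J j W R" for j W R v
      using that by (simp add: J_def)
  next
    fix j
    show "triple q (\<lambda>W R. J j W R \<and> W 3 0 = j)
        (RWrite 0 (WConst 0) (RDiv (RRead 0 (WConst 0)) (ROfWord (WConst 2)))) 7
        (\<lambda>W R. J (Suc j) W R \<and> W 3 0 = j)"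
      by (intro triple_conseq[OF triple_RWrite[where P = "\<lambda>W R. J j W R \<and> W 3 0 = j"
            and Q = "\<lambda>W R. J (Suc j) W R \<and> W 3 0 = j"]])
        (use q in \<open>auto simp: J_def\<close>)
  qed (use d q in \<open>auto simp: J_def loaded_def\<close>)
  have IJ: "J 0 W R" if "I M W R" for W R
    using that by (auto simp: I_def J_def)
  show ?thesis
    unfolding collect_def
    by (rule triple_conseq[OF triple_Seq[OF 1 triple_conseq[OF 2 IJ]]]) (auto simp: I_def J_def algebra_simps)
qed

lemma triple_summation:
  fixes d :: "nat list" and n m :: nat and x :: reals
  assumes d: "d ! 0 = M" "d ! 1 = b" "b > 0 \<Longrightarrow> even M" "length d = m * (n + 1)" "1 < length d"
    and q: "M + 1 < q" "2 < q" "b < q" "m * (n + 2) < q" "n + 1 < q" "m < q"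
    and x: "x 0 0 = 0" and "0 < m"
  defines "G \<equiv> \<lambda>r. (bfly (M div 2) ^^ b) (bucket_sum (n + 1) (\<lambda>i. d ! (i * m + (r - 1))) (x r))"
  shows "triple q (\<lambda>W R. loaded n d W \<and> (\<forall>a\<le>m. R a = x a) \<and> (\<forall>i\<in>{1..m}. R (m + i) = (\<lambda>_. 0)))
    (summation m)
    (m * ((n + 2) * 50 + (b + 1) * ((M + 1) * 100 + 11)) + 1 + ((M + 1) * (4 * m + 50) + (b + 1) * 50))
    (\<lambda>W R. R 0 0 = (\<Sum>u<M. \<Prod>i\<in>{1..m}. G i u) / 2 ^ b)"
  unfolding summation_def
proof (rule triple_Seq[OF triple_conseq[OF triple_transforms[OF d q order_refl]] triple_collect])
qed (use d q \<open>0 < m\<close> x in \<open>auto simp: G_def\<close>)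

text \<open>The interface between program and combinatorics: it suffices to give addresses
  \<open>a\<close>, a number \<open>M = O(n)\<close> of cells and a number \<open>b\<close> of
  rounds for which the normalised sum over the transformed buckets is the desired product
  sum.\<close>

lemma sums_within_summation:
  assumes m: "m \<in> {2, 3}" and "1 \<le> n"
    and a: "\<And>r i. r \<in> {1..m} \<Longrightarrow> i \<in> {1..n} \<Longrightarrow> a r i < M"
    and M: "M \<le> 16 * (n + 1)" "b \<le> M" "b > 0 \<Longrightarrow> even M"
    and sum: "\<And>x. (\<Sum>u<M. \<Prod>r\<in>{1..m}. (bfly (M div 2) ^^ b) (\<lambda>u. \<Sum>i\<in>{1..n}. if a r i = u then x r i else 0) u) / 2 ^ b
      = product_sum m S x"
    and \<tau>: "7000 * real (n + 1) * real (b + 1) \<le> \<tau>"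
  shows "sums_within ((n + 1) ^ 10) (summation m) m n S \<tau>"
proof -
  define q where "q = (n + 1) ^ 10"
  \<comment> \<open>From \<open>2 \<le> n + 1\<close> the modulus is at least
    \<open>512 * (n + 1)\<close>, beyond every length, address and counter in use.\<close>
  have "(2::nat) ^ 9 * (n + 1) \<le> (n + 1) ^ 9 * (n + 1)"
    using \<open>1 \<le> n\<close> by (intro mult_right_mono power_mono) auto
  also have "\<dots> = q" by (simp add: q_def numeral_eq_Suc)
  finally have "512 * (n + 1) \<le> q" by simp
  then have q: "M + 1 < q" "2 < q" "b < q" "m * (n + 2) < q" "n + 1 < q" "m < q"
    using M(1,2) m by auto
  \<comment> \<open>Row 0 of the address table belongs to no vector entry; as
    \<open>2 \<le> m\<close>, it has room for \<open>M\<close> and \<open>b\<close>.\<close>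
  define d where "d = map (\<lambda>j. if j = 0 then M else if j = 1 then b else if j < m then 0
      else a (j mod m + 1) (j div m)) [0..<m * (n + 1)]"
  have len: "length d = m * (n + 1)" by (simp add: d_def)
  have d01: "d ! 0 = M" "d ! 1 = b" "1 < length d"
    using m by (auto simp: d_def nth_append)
  have d_a: "d ! (i * m + (r - 1)) = a r i" if "r \<in> {1..m}" "i \<in> {1..n}" for r i
  proof -
    have "i * m + (r - 1) < i * m + m" using that by auto
    also have "\<dots> = (i + 1) * m" by simp
    also have "\<dots> \<le> (n + 1) * m" using that by (intro mult_right_mono) auto
    finally have 1: "i * m + (r - 1) < m * (n + 1)" by (simp add: mult.commute)
    have 2: "m \<le> i * m + (r - 1)" using that by (cases i) auto
    obtain r' where "r = Suc r'" "r' < m" using \<open>r \<in> {1..m}\<close> by (cases r) auto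
    then have "(i * m + (r - 1)) mod m + 1 = r" "(i * m + (r - 1)) div m = i"
      by auto
    then show ?thesis
      using 1 2 m that by (auto simp: d_def simp del: mod_mult_self3 div_mult_self3)
  qed
  have "a (j mod m + 1) (j div m) < M" if "\<not> j < m" "j < m * (n + 1)" for j
  proof (rule a)
    have "j div m < n + 1" using that by (simp add: less_mult_imp_div_less mult.commute)
    moreover have "1 \<le> j div m" using that m by (auto simp: div_greater_zero_iff Suc_le_eq)
    ultimately show "j div m \<in> {1..n}" by auto
    show "j mod m + 1 \<in> {1..m}" using m by (auto simp: Suc_le_eq)
  qed
  then have d_less: "w < q" if "w \<in> set d" for w
    using that q by (fastforce simp: d_def)
  have exec: "\<exists>t W R. exec q (summation m) (input_words n d, input_reals n m x) t (W, R) \<and>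
      real (length d + t) \<le> \<tau> \<and> R 0 0 = product_sum m S x" for x
  proof -
    let ?X = "input_reals n m x"
    have bucket: "bucket_sum (n + 1) (\<lambda>i. d ! (i * m + (r - 1))) (?X r) =
        (\<lambda>u. \<Sum>i\<in>{1..n}. if a r i = u then x r i else 0)" if "r \<in> {1..m}" for r
    proof
      fix u
      \<comment> \<open>Round 0 of \<open>scatter\<close> adds the zero input cell, so the bucket
        sums really start at index 1.\<close>
      have "?X r 0 = 0" by (simp add: input_reals_def)
      moreover have "{..<n + 1} = insert 0 {1..n}" by auto
      ultimately have "bucket_sum (n + 1) (\<lambda>i. d ! (i * m + (r - 1))) (?X r) u =
          (\<Sum>i\<in>{1..n}. if d ! (i * m + (r - 1)) = u then ?X r i else 0)"
        by (simp add: bucket_sum_def)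
      also have "\<dots> = (\<Sum>i\<in>{1..n}. if a r i = u then x r i else 0)"
        using that by (intro sum.cong refl) (simp only: d_a, simp add: input_reals_def)
      finally show "bucket_sum (n + 1) (\<lambda>i. d ! (i * m + (r - 1))) (?X r) u =
          (\<Sum>i\<in>{1..n}. if a r i = u then x r i else 0)" .
    qed
    obtain t W R where 1: "exec q (summation m) (input_words n d, ?X) t (W, R)"
        and 2: "t \<le> m * ((n + 2) * 50 + (b + 1) * ((M + 1) * 100 + 11)) + 1 +
          ((M + 1) * (4 * m + 50) + (b + 1) * 50)"
        and 3: "R 0 0 = (\<Sum>u<M. \<Prod>r\<in>{1..m}. (bfly (M div 2) ^^ b)
          (bucket_sum (n + 1) (\<lambda>i. d ! (i * m + (r - 1))) (?X r)) u) / 2 ^ b"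
      using triple_summation[where d = d and n = n and m = m and x = ?X and M = M and b = b and q = q,
          unfolded triple_def, OF d01(1,2) M(3) len d01(3) q, rule_format,
          of "input_words n d" ?X] m d01
      by (auto simp: input_reals_def loaded_def input_words_def)
    have "R 0 0 = product_sum m S x"
      unfolding 3 sum[symmetric]
      by (intro arg_cong2[where f = "(/)"] sum.cong prod.cong refl arg_cong[where f = "(bfly (M div 2) ^^ b)", THEN fun_cong] bucket)
    moreover have "length d + t \<le> 7000 * (n + 1) * (b + 1)"
    proof -
      have "M + 1 \<le> 17 * (n + 1)" using M(1) by simp
      have "m \<le> 3" using m by auto
      \<comment> \<open>Every summand is at most a constant times \<open>(n + 1) * (b + 1)\<close>.
        The butterflies dominate with \<open>3 * 17 * 100 = 5100\<close>; 7000 also covers the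
        rest.\<close>
      have "length d + t \<le> 3 * (n + 1) + (3 * ((n + 2) * 50 + (b + 1) * ((M + 1) * 100 + 11)) + 1 +
          ((M + 1) * (4 * 3 + 50) + (b + 1) * 50))"
        using 2 unfolding len using \<open>m \<le> 3\<close>
        by (intro add_mono order_trans[OF 2] mult_mono mult_right_mono add_mono order_refl) auto
      also have "\<dots> \<le> 3 * (n + 1) + (3 * ((n + 2) * 50 + (b + 1) * (17 * (n + 1) * 100 + 11)) + 1 +
          (17 * (n + 1) * (4 * 3 + 50) + (b + 1) * 50))"
        using \<open>M + 1 \<le> 17 * (n + 1)\<close>
        by (intro add_mono mult_mono order_refl) auto
      also have "\<dots> \<le> 7000 * (n + 1) * (b + 1)"
        by (simp add: algebra_simps)
      finally show ?thesis .
    qed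
    then have "real (length d + t) \<le> \<tau>"
      using \<tau> by (metis (no_types, opaque_lifting) of_nat_le_iff of_nat_mult of_nat_numeral order_trans)
    ultimately show ?thesis using 1 by blast
  qed
  show ?thesis
    unfolding sums_within_def q_def[symmetric] using d_less exec by blast
qed

subsection \<open>Random permutations of a pattern\<close>

definition random_perm :: "nat \<Rightarrow> (nat \<Rightarrow> nat) pmf" where
  "random_perm N = pmf_of_set {f. f permutes {..<N}}"

lemma perms_finite_nonempty: "finite {f. f permutes {..<N::nat}}" "{f. f permutes {..<N::nat}} \<noteq> {}"
  using permutes_id[of "{..<N}"] finite_permutations[of "{..<N}"] by (simp, blast)

lemma set_random_perm: "set_pmf (random_perm N) = {f. f permutes {..<N}}"
  unfolding random_perm_def by (rule set_pmf_of_set) (rule perms_finite_nonempty)+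

lemma permutes_lessThan_less: "f permutes {..<N::nat} \<Longrightarrow> i < N \<Longrightarrow> f i < N"
  using permutes_in_image[of f "{..<N}" i] by simp

text \<open>Left translation is a bijection of the permutation group, hence preserves the uniform
  distribution. The point probabilities below follow from this symmetry without counting
  permutations.\<close>

lemma random_perm_comp:
  assumes \<sigma>: "\<sigma> permutes {..<N}"
  shows "map_pmf (\<lambda>f. \<sigma> \<circ> f) (random_perm N) = random_perm N"
proof -
  have "bij_betw (\<lambda>f. \<sigma> \<circ> f) {f. f permutes {..<N}} {f. f permutes {..<N}}"
    by (rule bij_betwI[where g = "\<lambda>f. inv \<sigma> \<circ> f"])
      (auto simp: permutes_compose permutes_inv \<sigma> o_assoc permutes_inv_o[OF \<sigma>])
  then show ?thesis
    unfolding random_perm_def by (rule map_pmf_of_set_bij_betw) (use perms_finite_nonempty in blast)+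
qed

lemma prob_random_perm_comp:
  assumes "\<sigma> permutes {..<N}"
  shows "measure_pmf.prob (random_perm N) {f. P (\<sigma> \<circ> f)} = measure_pmf.prob (random_perm N) {f. P f}"
  by (subst (2) random_perm_comp[OF assms, symmetric]) simp

text \<open>The events \<open>f i = v\<close> for \<open>v < N\<close> are disjoint and exhaustive,
  and composing with transpositions shows that they are equiprobable.\<close>

lemma prob_random_perm_eq:
  assumes "i < N" "u < N"
  shows "measure_pmf.prob (random_perm N) {f. f i = u} = 1 / real N"
proof -
  let ?p = "\<lambda>v. measure_pmf.prob (random_perm N) {f. f i = v}"
  have eq: "?p v = ?p u" if "v < N" for v
  proof -
    have "Transposition.transpose u v permutes {..<N}" using assms that by (auto intro: permutes_swap_id)
    from prob_random_perm_comp[OF this, of "\<lambda>f. f i = v"]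
    moreover have "Transposition.transpose u v a = v \<longleftrightarrow> a = u" for a
      by (auto simp: Transposition.transpose_def)
    ultimately show ?thesis by simp
  qed
  have "f i < N" if "f permutes {..<N}" for f
    using that assms by (simp add: permutes_lessThan_less)
  then have "measure_pmf.prob (random_perm N) (\<Union>v\<in>{..<N}. {f. f i = v}) = 1"
    by (subst measure_pmf.prob_eq_1) (auto simp: AE_measure_pmf_iff set_random_perm)
  also have "measure_pmf.prob (random_perm N) (\<Union>v\<in>{..<N}. {f. f i = v}) = (\<Sum>v<N. ?p v)"
    by (rule measure_pmf.finite_measure_finite_Union) (auto simp: disjoint_family_on_def)
  also have "\<dots> = real N * ?p u"
    using eq by (simp)
  finally show ?thesis using assms by (auto simp: field_simps)
qed

lemma prob_random_perm_eq2:
  assumes "i < N" "j < N" "i \<noteq> j" "u < N" "v < N" "u \<noteq> v"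
  shows "measure_pmf.prob (random_perm N) {f. f i = u \<and> f j = v} = 1 / (real N * real (N - 1))"
proof -
  let ?p = "\<lambda>(u, v). measure_pmf.prob (random_perm N) {f. f i = u \<and> f j = v}"
  let ?I = "SIGMA u:{..<N}. {..<N} - {u}"
  have eq: "?p x = ?p (u, v)" if "x \<in> ?I" for x
  proof -
    obtain u' v' where x: "x = (u', v')" "u' < N" "v' < N" "u' \<noteq> v'" using \<open>x \<in> ?I\<close> by auto
    \<comment> \<open>The first swap sends \<open>u\<close> to \<open>u'\<close>; the second moves
      the current image of \<open>v\<close> to \<open>v'\<close> and fixes \<open>u'\<close>, since
      neither of the points it exchanges is \<open>u'\<close>.\<close>
    let ?\<sigma> = "Transposition.transpose (Transposition.transpose u u' v) v' \<circ> Transposition.transpose u u'"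
    have "Transposition.transpose u u' v < N" using assms x by (auto simp: Transposition.transpose_def)
    then have \<sigma>: "?\<sigma> permutes {..<N}" using assms x by (auto intro!: permutes_compose permutes_swap_id)
    have "?\<sigma> u = u'" "?\<sigma> v = v'" using assms x by (auto simp: Transposition.transpose_def)
    then have "?\<sigma> a = u' \<longleftrightarrow> a = u" "?\<sigma> a = v' \<longleftrightarrow> a = v" for a
      using permutes_inj[OF \<sigma>] by (metis injD)+
    then show ?thesis
      using prob_random_perm_comp[OF \<sigma>, of "\<lambda>f. f i = u' \<and> f j = v'"] x(1) by simp
  qed
  have "f i < N \<and> f j < N \<and> f i \<noteq> f j \<and> f j \<noteq> f i" if "f permutes {..<N}" for f
    using that assms permutes_inj[OF that] by (auto simp: permutes_lessThan_less dest: injD)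
  then have "measure_pmf.prob (random_perm N) (\<Union>(u, v)\<in>?I. {f. f i = u \<and> f j = v}) = 1"
    by (subst measure_pmf.prob_eq_1) (auto simp: AE_measure_pmf_iff set_random_perm)
  also have "measure_pmf.prob (random_perm N) (\<Union>(u, v)\<in>?I. {f. f i = u \<and> f j = v}) = (\<Sum>x\<in>?I. measure_pmf.prob (random_perm N) (case x of (u, v) \<Rightarrow> {f. f i = u \<and> f j = v}))"
    by (rule measure_pmf.finite_measure_finite_Union) (auto simp: disjoint_family_on_def)
  also have "\<dots> = (\<Sum>x\<in>?I. ?p (u, v))"
    by (rule sum.cong) (use eq in \<open>auto simp: split_def\<close>)
  also have "\<dots> = real N * real (N - 1) * ?p (u, v)"
    using assms by (simp add: card_SigmaI)
  finally show ?thesis using assms by (auto simp: field_simps)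
qed

section \<open>Random patterns and their pair probabilities\<close>

definition pattern_set :: "nat \<Rightarrow> nat \<Rightarrow> (nat \<Rightarrow> nat) set \<Rightarrow> (nat \<Rightarrow> nat \<Rightarrow> nat) \<Rightarrow> (nat \<Rightarrow> nat) set" where
  "pattern_set n m T h = {g \<in> grid n m. (\<lambda>k\<in>{1..m}. h k (g k)) \<in> T}"

definition pattern_sample :: "nat \<Rightarrow> nat \<Rightarrow> nat \<Rightarrow> (nat \<Rightarrow> nat) set \<Rightarrow> (nat \<Rightarrow> nat) set pmf" where
  "pattern_sample n m N T =
     map_pmf (pattern_set n m T) (Pi_pmf {1..m} id (\<lambda>_. random_perm N))"

lemma set_pattern_sample:
  assumes "S \<in> set_pmf (pattern_sample n m N T)" and "n < N"
  obtains h where "S = pattern_set n m T h" and "\<And>k i. k \<in> {1..m} \<Longrightarrow> i \<in> {1..n} \<Longrightarrow> h k i < N"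
proof -
  obtain h where h: "S = pattern_set n m T h" "h \<in> set_pmf (Pi_pmf {1..m} id (\<lambda>_. random_perm N))"
    using assms(1) unfolding pattern_sample_def by auto
  have "h k permutes {..<N}" if "k \<in> {1..m}" for k
    using h(2) \<open>k \<in> {1..m}\<close> by (auto simp: set_Pi_pmf PiE_dflt_def set_random_perm)
  \<comment> \<open>Grid coordinates run from 1 to \<open>n\<close>, whereas the permutations act on
    numbers below \<open>N\<close>; \<open>n < N\<close> makes the former a subset.\<close>
  then have "h k i < N" if "k \<in> {1..m}" "i \<in> {1..n}" for k i
    using that assms(2) by (auto intro: permutes_lessThan_less)
  with h(1) show ?thesis by (rule that)
qed

text \<open>The event splits according to the images \<open>t\<close> of \<open>i\<close> and
  \<open>t'\<close> of \<open>j\<close> in \<open>T\<close>, and for fixed images it factors over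
  the independent coordinates. Since each \<open>h k\<close> is injective, the factor vanishes
  unless \<open>t\<close> and \<open>t'\<close> agree exactly where \<open>i\<close> and
  \<open>j\<close> do; otherwise it is \<open>1 / N\<close> on \<open>A\<close> and
  \<open>1 / (N * (N - 1))\<close> off \<open>A\<close>.\<close>

lemma prob_pattern_sample_both:
  assumes T: "T \<subseteq> {1..m} \<rightarrow>\<^sub>E {..<N}" and ij: "i \<in> grid n m" "j \<in> grid n m" and N: "n < N" "1 < N"
  defines "A \<equiv> {k \<in> {1..m}. i k = j k}"
  shows "measure_pmf.prob (pattern_sample n m N T) {S. j \<in> S \<and> i \<in> S} =
    (\<Sum>t\<in>T. real (card {t' \<in> T. {k \<in> {1..m}. t k = t' k} = A})) / (real N ^ m * real (N - 1) ^ (m - card A))"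
proof -
  let ?H = "Pi_pmf {1..m} id (\<lambda>_. random_perm N)"
  let ?E = "\<lambda>t t'. Pi {1..m} (\<lambda>k. {f. f (i k) = t k \<and> f (j k) = t' k})"
  have fin: "finite T" by (rule finite_subset[OF T]) (intro finite_PiE, auto)
  have range: "t k < N" if "t \<in> T" "k \<in> {1..m}" for t k using T that by (auto simp: PiE_iff)
  have ij_range: "i k < N" "j k < N" if "k \<in> {1..m}" for k
  proof -
    have "i k \<in> {1..n}" "j k \<in> {1..n}"
      using ij that unfolding grid_def by (blast dest: PiE_mem)+
    then show "i k < N" "j k < N" using N by auto
  qed
  have A: "A \<subseteq> {1..m}" by (auto simp: A_def)
  have factor: "measure_pmf.prob (random_perm N) {f. f (i k) = t k \<and> f (j k) = t' k} =
      (if t k = t' k \<longleftrightarrow> k \<in> A then 1 / real N * (if k \<in> A then 1 else 1 / real (N - 1)) else 0)"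
    if "t \<in> T" "t' \<in> T" "k \<in> {1..m}" for t t' k
  proof (cases "i k = j k")
    case True
    then have "k \<in> A" using that by (simp add: A_def)
    show ?thesis
    proof (cases "t k = t' k")
      case True
      then show ?thesis using \<open>i k = j k\<close> \<open>k \<in> A\<close> prob_random_perm_eq that ij_range range by simp
    next
      case False
      then have "{f. f (i k) = t k \<and> f (j k) = t' k} = {}" using \<open>i k = j k\<close> by auto
      then have "measure_pmf.prob (random_perm N) {f. f (i k) = t k \<and> f (j k) = t' k} = 0"
        by (simp only: measure_empty)
      then show ?thesis using \<open>k \<in> A\<close> False by simp
    qed
  next
    case False
    then have "k \<notin> A" by (simp add: A_def)
    show ?thesis
    proof (cases "t k = t' k")
      case True
      have "measure_pmf.prob (random_perm N) {f. f (i k) = t k \<and> f (j k) = t' k} = 0"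
      proof -
        have "set_pmf (random_perm N) \<inter> {f. f (i k) = t k \<and> f (j k) = t' k} = {}"
        proof (intro equals0I)
          fix f assume "f \<in> set_pmf (random_perm N) \<inter> {f. f (i k) = t k \<and> f (j k) = t' k}"
          then have "f permutes {..<N}" "f (i k) = f (j k)"
            using True by (simp_all add: set_random_perm)
          then show False using permutes_inj False by (metis injD)
        qed
        then show ?thesis by (simp only: measure_pmf_zero_iff)
      qed
      then show ?thesis using \<open>k \<notin> A\<close> True by simp
    next
      case ne: False
      then show ?thesis
        using \<open>k \<notin> A\<close> prob_random_perm_eq2[OF ij_range[OF that(3)] False range[OF that(1,3)] range[OF that(2,3)] ne] by simp
    qed
  qed
  have pair: "measure_pmf.prob ?H (?E t t') =
      (if {k \<in> {1..m}. t k = t' k} = A then 1 / (real N ^ m * real (N - 1) ^ (m - card A)) else 0)"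
    if "t \<in> T" "t' \<in> T" for t t'
  proof -
    have p1: "measure_pmf.prob ?H (?E t t') =
        (\<Prod>k\<in>{1..m}. measure_pmf.prob (random_perm N) {f. f (i k) = t k \<and> f (j k) = t' k})"
      by (rule measure_Pi_pmf_Pi) simp
    have p2: "(\<Prod>k\<in>{1..m}. measure_pmf.prob (random_perm N) {f. f (i k) = t k \<and> f (j k) = t' k}) = (\<Prod>k\<in>{1..m}.
        if t k = t' k \<longleftrightarrow> k \<in> A then 1 / real N * (if k \<in> A then 1 else 1 / real (N - 1)) else 0)"
      by (rule prod.cong[OF refl], rule factor[OF that])
    have p3: "\<dots> = (if {k \<in> {1..m}. t k = t' k} = A then 1 / (real N ^ m * real (N - 1) ^ (m - card A)) else 0)"
    proof (cases "{k \<in> {1..m}. t k = t' k} = A")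
      case True
      have "(\<Prod>k\<in>{1..m}. if k \<in> A then 1 else 1 / real (N - 1)) =
          (\<Prod>k\<in>{1..m} - A. 1 / real (N - 1))"
        by (rule prod.mono_neutral_cong_right) auto
      also have "\<dots> = (1 / real (N - 1)) ^ (m - card A)"
        using A by (simp add: card_Diff_subset finite_subset)
      finally have *: "(\<Prod>k\<in>{1..m}. if k \<in> A then 1 else 1 / real (N - 1)) = (1 / real (N - 1)) ^ (m - card A)" .
      have "(\<Prod>k\<in>{1..m}. if t k = t' k \<longleftrightarrow> k \<in> A then 1 / real N * (if k \<in> A then 1 else 1 / real (N - 1)) else 0)
          = (\<Prod>k\<in>{1..m}. 1 / real N * (if k \<in> A then 1 else 1 / real (N - 1)))"
        using True by (intro prod.cong) auto
      also have "\<dots> = (1 / real N) ^ m * (1 / real (N - 1)) ^ (m - card A)"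
        unfolding prod.distrib * by simp
      finally show ?thesis using True by (simp add: power_one_over)
    next
      case False
      then obtain k where "k \<in> {1..m}" "\<not> (t k = t' k \<longleftrightarrow> k \<in> A)" using A by blast
      then have "(\<Prod>k\<in>{1..m}. if t k = t' k \<longleftrightarrow> k \<in> A then 1 / real N * (if k \<in> A then 1 else 1 / real (N - 1)) else 0) = 0"
        by (intro prod_zero) auto
      then show ?thesis using False by simp
    qed
    show ?thesis by (rule trans[OF p1 trans[OF p2 p3]])
  qed
  \<comment> \<open>Tuples in \<open>T\<close> are extensional, so equality with a restricted
    function is pointwise equality on \<open>{1..m}\<close>.\<close>
  have ext: "(\<lambda>k\<in>{1..m}. h k (g k)) = t \<longleftrightarrow> (\<forall>k\<in>{1..m}. h k (g k) = t k)" if "t \<in> T" for h t and g :: "nat \<Rightarrow> nat"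
    using T that by (auto simp: fun_eq_iff PiE_iff extensional_def restrict_def)
  have "pattern_set n m T -` {S. j \<in> S \<and> i \<in> S} = (\<Union>(t, t')\<in>T \<times> T. ?E t t')"
  proof (intro set_eqI iffI)
    fix h assume "h \<in> pattern_set n m T -` {S. j \<in> S \<and> i \<in> S}"
    then have "(\<lambda>k\<in>{1..m}. h k (i k)) \<in> T" "(\<lambda>k\<in>{1..m}. h k (j k)) \<in> T"
      by (auto simp: pattern_set_def)
    moreover have "h \<in> ?E (\<lambda>k\<in>{1..m}. h k (i k)) (\<lambda>k\<in>{1..m}. h k (j k))" by auto
    ultimately show "h \<in> (\<Union>(t, t')\<in>T \<times> T. ?E t t')" by blast
  next
    fix h assume "h \<in> (\<Union>(t, t')\<in>T \<times> T. ?E t t')"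
    then obtain t t' where t: "t \<in> T" "t' \<in> T" "h \<in> ?E t t'" by blast
    then have "\<forall>k\<in>{1..m}. h k (i k) = t k" "\<forall>k\<in>{1..m}. h k (j k) = t' k" by auto
    then have "(\<lambda>k\<in>{1..m}. h k (i k)) = t" "(\<lambda>k\<in>{1..m}. h k (j k)) = t'"
      using ext[OF t(1), of h i] ext[OF t(2), of h j] by blast+
    then show "h \<in> pattern_set n m T -` {S. j \<in> S \<and> i \<in> S}"
      using t ij by (simp add: pattern_set_def)
  qed
  then have "measure_pmf.prob (pattern_sample n m N T) {S. j \<in> S \<and> i \<in> S} =
      measure_pmf.prob ?H (\<Union>x\<in>T \<times> T. case x of (t, t') \<Rightarrow> ?E t t')"
    by (simp add: pattern_sample_def)
  also have "\<dots> = (\<Sum>x\<in>T \<times> T. measure_pmf.prob ?H (case x of (t, t') \<Rightarrow> ?E t t'))"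
  proof (rule measure_pmf.finite_measure_finite_Union)
    show "disjoint_family_on (\<lambda>x. case x of (t, t') \<Rightarrow> ?E t t') (T \<times> T)"
      unfolding disjoint_family_on_def
    proof (intro ballI impI)
      fix x y assume xy: "x \<in> T \<times> T" "y \<in> T \<times> T" "x \<noteq> y"
      obtain t t' where x: "x = (t, t')" by (cases x)
      obtain s s' where y: "y = (s, s')" by (cases y)
      have "t = s \<and> t' = s'" if "h \<in> ?E t t'" "h \<in> ?E s s'" for h
        using that xy x y ext[of t h i] ext[of s h i] ext[of t' h j] ext[of s' h j] by (auto simp: Pi_iff)
      then show "(case x of (t, t') \<Rightarrow> ?E t t') \<inter> (case y of (t, t') \<Rightarrow> ?E t t') = {}"
        using xy x y by blast
    qed
  qed (use fin in auto)
  also have "\<dots> = (\<Sum>t\<in>T. \<Sum>t'\<in>T. measure_pmf.prob ?H (?E t t'))"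
    by (simp add: sum.cartesian_product split_def)
  also have "\<dots> = (\<Sum>t\<in>T. \<Sum>t'\<in>T. if {k \<in> {1..m}. t k = t' k} = A then 1 / (real N ^ m * real (N - 1) ^ (m - card A)) else 0)"
    by (intro sum.cong refl pair)
  also have "\<dots> = (\<Sum>t\<in>T. real (card {t' \<in> T. {k \<in> {1..m}. t k = t' k} = A}) / (real N ^ m * real (N - 1) ^ (m - card A)))"
    using fin by (intro sum.cong refl) (simp add: sum.If_cases Int_def)
  finally show ?thesis by (simp add: sum_divide_distrib)
qed

text \<open>By \<open>spread\<close>, the number of pairs in \<open>T\<close> agreeing exactly on
  \<open>A\<close> is at most \<open>card T ^ 2 / N ^ card A\<close>. Dividing by the marginal
  bounds the conditional probability by
  \<open>card T / (N ^ card A * (N - 1) ^ (m - card A))\<close>. The factor 2 allowed in a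
  \<open>p\<close>-sample absorbs the loss from \<open>N\<close> to \<open>N - 1\<close>.\<close>

lemma p_sample_pattern:
  assumes T: "T \<subseteq> {1..m} \<rightarrow>\<^sub>E {..<N}" and N: "n < N" "1 < N" "N ^ m \<le> 2 * (N - 1) ^ m"
    and dens: "p / 2 \<le> real (card T) / real N ^ m" "real (card T) / real N ^ m \<le> p" and "0 < p"
    and spread: "\<And>t A. t \<in> T \<Longrightarrow> A \<subset> {1..m} \<Longrightarrow>
      N ^ card A * card {t' \<in> T. {k \<in> {1..m}. t k = t' k} = A} \<le> card T"
  shows "p_sample p (grid n m) (pattern_sample n m N T)"
proof -
  let ?D = "pattern_sample n m N T"
  have fin: "finite T" by (rule finite_subset[OF T]) (intro finite_PiE, auto)
  have marginal: "measure_pmf.prob ?D {S. i \<in> S} = real (card T) / real N ^ m" if "i \<in> grid n m" for i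
  proof -
    \<comment> \<open>The marginal is the diagonal case of the pair formula: \<open>A\<close> is all
      of \<open>{1..m}\<close>, and a tuple agrees everywhere only with itself.\<close>
    have idx: "{k \<in> {1..m}. i k = i k} = {1..m}" by auto
    have "{t' \<in> T. {k \<in> {1..m}. t k = t' k} = {1..m}} = {t}" if "t \<in> T" for t
    proof -
      have "t' = t" if "t' \<in> T" "{k \<in> {1..m}. t k = t' k} = {1..m}" for t'
      proof (rule PiE_ext[of t' "{1..m}" "\<lambda>_. {..<N}"])
        show "t' k = t k" if "k \<in> {1..m}" for k
          using that \<open>{k \<in> {1..m}. t k = t' k} = {1..m}\<close> by (metis (mono_tags, lifting) mem_Collect_eq)
      qed (use T that \<open>t \<in> T\<close> in auto)
      moreover have "{k \<in> {1..m}. t k = t k} = {1..m}" by auto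
      ultimately show ?thesis using \<open>t \<in> T\<close> by blast
    qed
    then show ?thesis
      using prob_pattern_sample_both[OF T that that N(1,2), unfolded idx] by simp
  qed
  have cond: "\<P>(S in measure_pmf ?D. j \<in> S \<bar> i \<in> S) \<le> 2 * p"
    if ij: "i \<in> grid n m" "j \<in> grid n m" "j \<noteq> i" for i j
  proof -
    define A where "A = {k \<in> {1..m}. i k = j k}"
    have "A \<noteq> {1..m}"
    proof
      assume "A = {1..m}"
      have "j = i"
      proof (rule PiE_ext[of j "{1..m}" "\<lambda>_. {1..n}"])
        show "j k = i k" if "k \<in> {1..m}" for k
          using that \<open>A = {1..m}\<close> unfolding A_def by (metis (mono_tags, lifting) mem_Collect_eq)
      qed (use ij in \<open>auto simp: grid_def\<close>)
      then show False using ij by simp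
    qed
    then have A: "A \<subset> {1..m}" by (auto simp: A_def)
    then have cA: "card A \<le> m" using card_mono[of "{1..m}" A] by auto
    have pos: "0 < real (card T) / real N ^ m" using dens \<open>0 < p\<close> by linarith
    then have cT: "0 < real (card T)" using N by (simp add: zero_less_divide_iff)
    have N0: "0 < real N" "0 < real (N - 1)" using N by auto
    have "(\<Sum>t\<in>T. real (card {t' \<in> T. {k \<in> {1..m}. t k = t' k} = A})) \<le> (\<Sum>t\<in>T. real (card T) / real N ^ card A)"
    proof (rule sum_mono)
      fix t assume "t \<in> T"
      from spread[OF this A] have "real (N ^ card A * card {t' \<in> T. {k \<in> {1..m}. t k = t' k} = A}) \<le> real (card T)"
        unfolding of_nat_le_iff .
      then show "real (card {t' \<in> T. {k \<in> {1..m}. t k = t' k} = A}) \<le> real (card T) / real N ^ card A"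
        using N0 by (simp add: field_simps)
    qed
    then have "(\<Sum>t\<in>T. real (card {t' \<in> T. {k \<in> {1..m}. t k = t' k} = A})) \<le> real (card T) * (real (card T) / real N ^ card A)"
      by simp
    then have both: "measure_pmf.prob ?D {S. j \<in> S \<and> i \<in> S} \<le>
        real (card T) * (real (card T) / real N ^ card A) / (real N ^ m * real (N - 1) ^ (m - card A))"
      unfolding prob_pattern_sample_both[OF T ij(1,2) N(1,2)] A_def[symmetric]
      using N0 by (intro divide_right_mono) auto
    have "real N ^ m \<le> 2 * (real (N - 1) ^ card A * real (N - 1) ^ (m - card A))"
      using N(3)[THEN of_nat_mono[where 'a = real]] cA by (simp flip: power_add)
    also have "\<dots> \<le> 2 * (real N ^ card A * real (N - 1) ^ (m - card A))"
      using N0 by (intro mult_left_mono mult_right_mono power_mono) auto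
    finally have Nm: "real N ^ m \<le> 2 * (real N ^ card A * real (N - 1) ^ (m - card A))" .
    have "\<P>(S in measure_pmf ?D. j \<in> S \<bar> i \<in> S) =
        measure_pmf.prob ?D {S. j \<in> S \<and> i \<in> S} / (real (card T) / real N ^ m)"
      using marginal[OF ij(1)] by (simp add: cond_prob_def)
    also have "\<dots> \<le> real (card T) * (real (card T) / real N ^ card A) / (real N ^ m * real (N - 1) ^ (m - card A)) /
        (real (card T) / real N ^ m)"
      using both pos by (intro divide_right_mono) auto
    also have "\<dots> = real (card T) / (real N ^ card A * real (N - 1) ^ (m - card A))"
      using cT N0 by (simp add: field_simps)
    also have "\<dots> \<le> real (card T) / (real N ^ m / 2)"
      using Nm N0 by (intro divide_left_mono) auto
    also have "\<dots> = 2 * (real (card T) / real N ^ m)" by simp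
    also have "\<dots> \<le> 2 * p" using dens by simp
    finally show ?thesis .
  qed
  have "finite (grid n m)" by (auto simp: grid_def intro: finite_PiE)
  moreover have "set_pmf ?D \<subseteq> Pow (grid n m)" by (auto simp: pattern_sample_def pattern_set_def)
  ultimately show ?thesis
    unfolding p_sample_def using marginal dens cond by simp
qed

subsection \<open>The xor tensor\<close>

text \<open>An even sum means that the lowest bits have xor 0. So the lowest \<open>b\<close> bits
  are constrained by xor, and \<open>Z\<close> judges the remaining upper parts.\<close>

primrec xor_rel :: "(nat \<Rightarrow> nat \<Rightarrow> nat \<Rightarrow> bool) \<Rightarrow> nat \<Rightarrow> nat \<Rightarrow> nat \<Rightarrow> nat \<Rightarrow> bool" where
  "xor_rel Z 0 u v w \<longleftrightarrow> Z u v w"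
| "xor_rel Z (Suc b) u v w \<longleftrightarrow> even (u + v + w) \<and> xor_rel Z b (u div 2) (v div 2) (w div 2)"

definition eq3 :: "nat \<Rightarrow> nat \<Rightarrow> nat \<Rightarrow> bool" where
  "eq3 u v w \<longleftrightarrow> u = v \<and> v = w"

lemma xor_rel_swap:
  assumes "\<And>u v w. Z u v w \<longleftrightarrow> Z v u w"
  shows "xor_rel Z b u v w \<longleftrightarrow> xor_rel Z b v u w"
  using assms by (induction b arbitrary: u v w) (auto simp: add.commute)

lemma xor_rel_swap':
  assumes "\<And>u v w. Z u v w \<longleftrightarrow> Z u w v"
  shows "xor_rel Z b u v w \<longleftrightarrow> xor_rel Z b u w v"
proof (induction b arbitrary: u v w)
  case (Suc b)
  show ?case using Suc.IH[of "u div 2" "v div 2" "w div 2"] by (simp add: ac_simps)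
qed (use assms in auto)

text \<open>Residues modulo \<open>2 ^ b\<close> have upper parts 0, which are trivially equal.
  Hence the pattern with free upper parts is also an \<open>eq3\<close> pattern, on only
  \<open>2 ^ b\<close> addresses, and one program serves both.\<close>

lemma xor_rel_mod:
  "xor_rel (\<lambda>u v w. True) b u v w \<longleftrightarrow> xor_rel eq3 b (u mod 2 ^ b) (v mod 2 ^ b) (w mod 2 ^ b)"
proof (induction b arbitrary: u v w)
  case (Suc b)
  have 1: "(x mod 2 ^ Suc b) div 2 = (x div 2) mod 2 ^ b" for x :: nat
    by (simp add: mod_mult2_eq)
  have 2: "even (x mod 2 ^ Suc b) \<longleftrightarrow> even x" for x :: nat
    by (simp add: dvd_mod_iff)
  show ?case
    unfolding xor_rel.simps 1 Suc.IH[symmetric] even_add 2 ..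
qed (simp add: eq3_def)

text \<open>The top bit produced by a butterfly is one on which the relation demands equality.\<close>

lemma xor_rel_shift:
  assumes "2 ^ b dvd H" "u < H" "v < H" "w < H" "d \<le> 1" "e \<le> 1" "f \<le> 1"
  shows "xor_rel eq3 b (u + d * H) (v + e * H) (w + f * H) \<longleftrightarrow> xor_rel eq3 b u v w \<and> d = e \<and> e = f"
  using assms(1-4)
proof (induction b arbitrary: H u v w)
  case 0
  have "x + i * H = y + j * H \<longleftrightarrow> x = y \<and> i = j" if "x < H" "y < H" "i \<le> 1" "j \<le> 1" for x y i j
    using that by (auto simp: le_Suc_eq)
  then show ?case using 0 assms(5-7) by (auto simp: eq3_def)
next
  case (Suc b)
  then obtain K where H: "H = 2 * K" "2 ^ b dvd K" by (auto elim!: dvdE)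
  have 1: "(x + i * H) div 2 = x div 2 + i * K" for x i using H by simp
  have 2: "even (x + i * H) \<longleftrightarrow> even x" for x i using H by simp
  show ?case
    unfolding xor_rel.simps 1 even_add[of "_ + _"] 2
    using Suc.IH[of K "u div 2" "v div 2" "w div 2"] Suc.prems H by auto
qed

section \<open>Diagonalising the trilinear form of the xor relation\<close>

definition trilinear :: "nat \<Rightarrow> (nat \<Rightarrow> nat \<Rightarrow> nat \<Rightarrow> bool) \<Rightarrow>
    (nat \<Rightarrow> real) \<Rightarrow> (nat \<Rightarrow> real) \<Rightarrow> (nat \<Rightarrow> real) \<Rightarrow> real" where
  "trilinear M P f g h = (\<Sum>u<M. \<Sum>v<M. \<Sum>w<M. if P u v w then f u * g v * h w else 0)"

lemma sum_even_odd:
  fixes f :: "nat \<Rightarrow> 'a::comm_monoid_add"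
  shows "(\<Sum>u<2 * H. f u) = (\<Sum>u<H. f (2 * u) + f (2 * u + 1))"
  by (induction H) (auto simp: ac_simps)

lemma sum_halves:
  fixes f :: "nat \<Rightarrow> 'a::comm_monoid_add"
  shows "(\<Sum>u<2 * H. f u) = (\<Sum>u<H. f u + f (u + H))"
proof -
  have "(\<Sum>u<H + K. f u) = (\<Sum>u<H. f u) + (\<Sum>u<K. f (u + H))" for K
    by (induction K) (auto simp: ac_simps)
  from this[of H] show ?thesis by (simp add: sum.distrib mult_2)
qed

text \<open>For fixed upper bits, the relation admits the four choices of lowest bits with even sum.
  By \<open>polarize\<close>, their contribution is half the product of the three sums plus half the
  product of the three differences. These are the terms with all indices in the lower half or all in
  the upper half; by \<open>xor_rel_shift\<close> mixed halves contribute nothing.\<close>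

lemma trilinear_bfly:
  assumes "2 ^ b dvd H"
  shows "trilinear (2 * H) (xor_rel eq3 (Suc b)) f g h =
    trilinear (2 * H) (xor_rel eq3 b) (bfly H f) (bfly H g) (bfly H h) / 2"
proof -
  let ?R = "xor_rel eq3 b"
  \<comment> \<open>\<open>1\<close> splits each index by its lowest bit, as the left side needs;
    \<open>2\<close> splits by halves, as the right side needs.\<close>
  have 1: "(\<Sum>u<2 * H. \<Sum>v<2 * H. \<Sum>w<2 * H. F u v w) = (\<Sum>u<H. \<Sum>v<H. \<Sum>w<H.
      F (2 * u) (2 * v) (2 * w) + F (2 * u) (2 * v) (2 * w + 1) + F (2 * u) (2 * v + 1) (2 * w) + F (2 * u) (2 * v + 1) (2 * w + 1) +
      F (2 * u + 1) (2 * v) (2 * w) + F (2 * u + 1) (2 * v) (2 * w + 1) + F (2 * u + 1) (2 * v + 1) (2 * w) + F (2 * u + 1) (2 * v + 1) (2 * w + 1))"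
    for F :: "nat \<Rightarrow> nat \<Rightarrow> nat \<Rightarrow> real"
    unfolding sum_even_odd by (simp only: sum.distrib add.assoc)
  have 2: "(\<Sum>u<2 * H. \<Sum>v<2 * H. \<Sum>w<2 * H. F u v w) = (\<Sum>u<H. \<Sum>v<H. \<Sum>w<H.
      F u v w + F u v (w + H) + F u (v + H) w + F u (v + H) (w + H) +
      F (u + H) v w + F (u + H) v (w + H) + F (u + H) (v + H) w + F (u + H) (v + H) (w + H))"
    for F :: "nat \<Rightarrow> nat \<Rightarrow> nat \<Rightarrow> real"
    unfolding sum_halves by (simp only: sum.distrib add.assoc)
  have shift: "?R (u + H) v w = False" "?R u (v + H) w = False" "?R u v (w + H) = False"
      "?R (u + H) (v + H) w = False" "?R (u + H) v (w + H) = False" "?R u (v + H) (w + H) = False"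
      "?R (u + H) (v + H) (w + H) = ?R u v w" if "u < H" "v < H" "w < H" for u v w
    using xor_rel_shift[OF assms that, of 1 0 0] xor_rel_shift[OF assms that, of 0 1 0]
      xor_rel_shift[OF assms that, of 0 0 1] xor_rel_shift[OF assms that, of 1 1 0]
      xor_rel_shift[OF assms that, of 1 0 1] xor_rel_shift[OF assms that, of 0 1 1]
      xor_rel_shift[OF assms that, of 1 1 1] by simp_all
  have b1: "bfly H k u = k (2 * u) + k (2 * u + 1)" "bfly H k (u + H) = k (2 * u) - k (2 * u + 1)"
    if "u < H" for k u
    using that by (simp_all add: bfly_def)
  have polarize: "a * b * c + a * b' * c' + a' * b * c' + a' * b' * c =
      ((a + a') * (b + b') * (c + c') + (a - a') * (b - b') * (c - c')) / 2"
    for a a' b b' c c' :: real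
    by (simp add: algebra_simps)
  show ?thesis
    unfolding trilinear_def
  proof (subst 1, subst 2, unfold sum_divide_distrib, intro sum.cong refl, goal_cases)
    case uvw: (1 u v w)
    show ?case
    proof (cases "?R u v w")
      case True
      then show ?thesis
        using uvw by (simp add: shift b1 polarize)
    next
      case False
      then show ?thesis
        using uvw by (simp add: shift b1)
    qed
  qed
qed

lemma trilinear_eq3: "trilinear M eq3 f g h = (\<Sum>u<M. f u * g u * h u)"
proof -
  have *: "(if eq3 u v w then f u * g v * h w else 0) =
      (if w = v then if u = v then f u * g v * h w else 0 else 0)" for u v w
    by (auto simp: eq3_def)
  show ?thesis unfolding trilinear_def * by (auto intro!: sum.cong)
qed

text \<open>Each round trades one parity constraint for one equality constraint at the price of a
  factor 1/2; after \<open>b\<close> rounds only the diagonal form \<open>eq3\<close> is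
  left.\<close>

lemma trilinear_xor_rel:
  assumes "2 ^ b dvd M"
  shows "trilinear M (xor_rel eq3 b) f g h =
    (\<Sum>u<M. (bfly (M div 2) ^^ b) f u * (bfly (M div 2) ^^ b) g u * (bfly (M div 2) ^^ b) h u) / 2 ^ b"
  using assms
proof (induction b arbitrary: f g h)
  case 0
  have "xor_rel eq3 0 = eq3" by (intro ext) simp
  then show ?case by (simp add: trilinear_eq3)
next
  case (Suc b)
  then have M: "M = 2 * (M div 2)" "2 ^ b dvd M div 2" "2 ^ b dvd M" by (auto elim!: dvdE)
  have "trilinear M (xor_rel eq3 (Suc b)) f g h =
      trilinear M (xor_rel eq3 b) (bfly (M div 2) f) (bfly (M div 2) g) (bfly (M div 2) h) / 2"
    using trilinear_bfly[OF M(2)] M(1) by simp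
  then show ?case
    unfolding Suc.IH[OF M(3)] funpow_Suc_right o_apply by (simp add: mult.commute del: xor_rel.simps)
qed

lemma sum_bucket:
  assumes "\<And>i. i \<in> I \<Longrightarrow> a i < (M::nat)"
  shows "(\<Sum>u<M. (\<Sum>i\<in>I. if a i = u then x i else 0) * \<phi> u) = (\<Sum>i\<in>I. x i * \<phi> (a i) :: real)"
proof -
  have "(\<Sum>u<M. (\<Sum>i\<in>I. if a i = u then x i else 0) * \<phi> u) =
      (\<Sum>i\<in>I. \<Sum>u<M. if u = a i then x i * \<phi> u else 0)"
    unfolding sum_distrib_right by (subst sum.swap) (auto intro!: sum.cong)
  also have "\<dots> = (\<Sum>i\<in>I. x i * \<phi> (a i))"
    using assms by (intro sum.cong) auto
  finally show ?thesis .
qed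

lemma trilinear_buckets:
  fixes x y z :: "nat \<Rightarrow> real"
  assumes "\<And>i. i \<in> I \<Longrightarrow> a i < M" "\<And>i. i \<in> I \<Longrightarrow> b i < M" "\<And>i. i \<in> I \<Longrightarrow> c i < M"
  shows "trilinear M P (\<lambda>u. \<Sum>i\<in>I. if a i = u then x i else 0)
      (\<lambda>u. \<Sum>i\<in>I. if b i = u then y i else 0) (\<lambda>u. \<Sum>i\<in>I. if c i = u then z i else 0) =
    (\<Sum>i\<in>I. \<Sum>j\<in>I. \<Sum>k\<in>I. if P (a i) (b j) (c k) then x i * y j * z k else 0)"
proof -
  \<comment> \<open>As a nested product the form is linear in one vector at a time, so
    \<open>sum_bucket\<close> applies to the three sums separately.\<close>
  have pull: "(if Q then f * g * h else 0) = f * (g * (h * of_bool Q))" for Q and f g h :: real by simp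
  have "trilinear M P (\<lambda>u. \<Sum>i\<in>I. if a i = u then x i else 0)
      (\<lambda>u. \<Sum>i\<in>I. if b i = u then y i else 0) (\<lambda>u. \<Sum>i\<in>I. if c i = u then z i else 0) =
     (\<Sum>i\<in>I. x i * (\<Sum>j\<in>I. y j * (\<Sum>k\<in>I. z k * of_bool (P (a i) (b j) (c k)))))"
    unfolding trilinear_def pull sum_distrib_left[symmetric]
    by (simp only: sum_bucket[OF assms(1)] sum_bucket[OF assms(2)] sum_bucket[OF assms(3)])
  then show ?thesis
    unfolding pull sum_distrib_left[symmetric] .
qed

section \<open>Product sums over the grid and their evaluation by the program\<close>

lemma bij_betw_PiE2:
  "bij_betw (\<lambda>t. (t 1, t 2)) ({1..2::nat} \<rightarrow>\<^sub>E U) (U \<times> U)"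
proof (rule bij_betwI[where g = "\<lambda>(u, v). \<lambda>k\<in>{1..2}. if k = 1 then u else v"])
  show "(case (t 1, t 2) of (u, v) \<Rightarrow> \<lambda>k\<in>{1..2}. if k = 1 then u else v) = t"
    if "t \<in> {1..2::nat} \<rightarrow>\<^sub>E U" for t
    using that by (auto simp: fun_eq_iff PiE_def extensional_def le_Suc_eq numeral_eq_Suc)
qed (auto simp: PiE_mem)

lemma bij_betw_PiE3:
  "bij_betw (\<lambda>t. (t 1, t 2, t 3)) ({1..3::nat} \<rightarrow>\<^sub>E U) (U \<times> U \<times> U)"
proof (rule bij_betwI[where g = "\<lambda>(u, v, w). \<lambda>k\<in>{1..3}. if k = 1 then u else if k = 2 then v else w"])
  show "(case (t 1, t 2, t 3) of (u, v, w) \<Rightarrow>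
      \<lambda>k\<in>{1..3}. if k = 1 then u else if k = 2 then v else w) = t"
    if "t \<in> {1..3::nat} \<rightarrow>\<^sub>E U" for t
    using that by (auto simp: fun_eq_iff PiE_def extensional_def le_Suc_eq numeral_eq_Suc)
qed (auto simp: PiE_mem)

lemma prod_123: "(\<Prod>k\<in>{1..3::nat}. f k) = f 1 * f 2 * f (3::nat)" for f :: "nat \<Rightarrow> 'a::comm_monoid_mult"
  by (simp add: numeral_eq_Suc mult.assoc)

lemma prod_12: "(\<Prod>k\<in>{1..2::nat}. f k) = f 1 * f (2::nat)" for f :: "nat \<Rightarrow> 'a::comm_monoid_mult"
  by (simp add: numeral_eq_Suc)

lemma finite_grid: "finite (grid n m)"
  by (auto simp: grid_def intro: finite_PiE)

lemma product_sum_3: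
  "product_sum 3 {g \<in> grid n 3. P (g 1) (g 2) (g 3)} x =
    (\<Sum>i\<in>{1..n}. \<Sum>j\<in>{1..n}. \<Sum>k\<in>{1..n}. if P i j k then x 1 i * x 2 j * x 3 k else 0)"
proof -
  have "product_sum 3 {g \<in> grid n 3. P (g 1) (g 2) (g 3)} x =
      (\<Sum>g\<in>grid n 3. (\<lambda>(i, j, k). if P i j k then x 1 i * x 2 j * x 3 k else 0) (g 1, g 2, g 3))"
    unfolding product_sum_def prod_123 by (rule sum.mono_neutral_cong_left) (auto simp: finite_grid)
  also have "\<dots> = (\<Sum>(i, j, k)\<in>{1..n} \<times> {1..n} \<times> {1..n}. if P i j k then x 1 i * x 2 j * x 3 k else 0)"
    unfolding grid_def by (rule sum.reindex_bij_betw[OF bij_betw_PiE3])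
  finally show ?thesis by (simp add: sum.cartesian_product)
qed

lemma product_sum_2:
  "product_sum 2 {g \<in> grid n 2. P (g 1) (g 2)} x =
    (\<Sum>i\<in>{1..n}. \<Sum>j\<in>{1..n}. if P i j then x 1 i * x 2 j else 0)"
proof -
  have "product_sum 2 {g \<in> grid n 2. P (g 1) (g 2)} x =
      (\<Sum>g\<in>grid n 2. (\<lambda>(i, j). if P i j then x 1 i * x 2 j else 0) (g 1, g 2))"
    unfolding product_sum_def prod_12 by (rule sum.mono_neutral_cong_left) (auto simp: finite_grid)
  also have "\<dots> = (\<Sum>(i, j)\<in>{1..n} \<times> {1..n}. if P i j then x 1 i * x 2 j else 0)"
    unfolding grid_def by (rule sum.reindex_bij_betw[OF bij_betw_PiE2])
  finally show ?thesis by (simp add: sum.cartesian_product)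
qed

text \<open>The program evaluates the diagonal form of \<open>trilinear_xor_rel\<close>. Addresses
  may collide: entries sharing a cell are related to the same things, and
  \<open>trilinear_buckets\<close> separates them again.\<close>

lemma sums_within_xor:
  fixes a :: "nat \<Rightarrow> nat \<Rightarrow> nat"
  assumes "1 \<le> n" and a: "\<And>r i. r \<in> {1..3} \<Longrightarrow> i \<in> {1..n} \<Longrightarrow> a r i < M"
    and M: "M \<le> 16 * (n + 1)" "2 ^ b dvd M"
    and \<tau>: "7000 * real (n + 1) * real (b + 1) \<le> \<tau>"
  shows "sums_within ((n + 1) ^ 10) (summation 3) 3 n
    {g \<in> grid n 3. xor_rel eq3 b (a 1 (g 1)) (a 2 (g 2)) (a 3 (g 3))} \<tau>"
proof (rule sums_within_summation[where a = a and M = M and b = b])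
  have "0 < M" using a[of 1 1] \<open>1 \<le> n\<close> by auto
  then have "2 ^ b \<le> M" using M(2) by (rule dvd_imp_le[rotated])
  then show "b \<le> M" using less_exp[of b] by linarith
  show "even M" if "b > 0" using M(2) that by (meson dvd_power dvd_trans)
  fix x :: "nat \<Rightarrow> nat \<Rightarrow> real"
  let ?B = "\<lambda>r u. \<Sum>i\<in>{1..n}. if a r i = u then x r i else 0"
  have "(\<Sum>u<M. \<Prod>r\<in>{1..3}. (bfly (M div 2) ^^ b) (?B r) u) / 2 ^ b =
      trilinear M (xor_rel eq3 b) (?B 1) (?B 2) (?B 3)"
    unfolding prod_123 trilinear_xor_rel[OF M(2)] ..
  also have "\<dots> = product_sum 3 {g \<in> grid n 3. xor_rel eq3 b (a 1 (g 1)) (a 2 (g 2)) (a 3 (g 3))} x"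
    unfolding product_sum_3[where P = "\<lambda>i j k. xor_rel eq3 b (a 1 i) (a 2 j) (a 3 k)"]
    by (rule trilinear_buckets) (use a in auto)
  finally show "(\<Sum>u<M. \<Prod>r\<in>{1..3}. (bfly (M div 2) ^^ b) (?B r) u) / 2 ^ b =
      product_sum 3 {g \<in> grid n 3. xor_rel eq3 b (a 1 (g 1)) (a 2 (g 2)) (a 3 (g 3))} x" .
qed (use assms in auto)

text \<open>No transform is involved: the sum is the inner product of the two bucket vectors, which
  is the program with \<open>b = 0\<close> and linear time.\<close>

lemma sums_within_equal_2:
  fixes a :: "nat \<Rightarrow> nat \<Rightarrow> nat"
  assumes "1 \<le> n" and a: "\<And>r i. r \<in> {1..2} \<Longrightarrow> i \<in> {1..n} \<Longrightarrow> a r i < M"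
    and M: "M \<le> 16 * (n + 1)" and \<tau>: "7000 * real (n + 1) \<le> \<tau>"
  shows "sums_within ((n + 1) ^ 10) (summation 2) 2 n {g \<in> grid n 2. a 1 (g 1) = a 2 (g 2)} \<tau>"
proof (rule sums_within_summation[where a = a and M = M and b = 0])
  fix x :: "nat \<Rightarrow> nat \<Rightarrow> real"
  let ?B = "\<lambda>r u. \<Sum>i\<in>{1..n}. if a r i = u then x r i else 0"
  have "(\<Sum>u<M. \<Prod>r\<in>{1..2}. (bfly (M div 2) ^^ 0) (?B r) u) / 2 ^ 0 = (\<Sum>u<M. ?B 1 u * ?B 2 u)"
    unfolding prod_12 by simp
  also have "\<dots> = (\<Sum>i\<in>{1..n}. x 1 i * ?B 2 (a 1 i))"
    by (rule sum_bucket) (use a in auto)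
  also have "\<dots> = product_sum 2 {g \<in> grid n 2. a 1 (g 1) = a 2 (g 2)} x"
    unfolding product_sum_2[where P = "\<lambda>i j. a 1 i = a 2 j"] sum_distrib_left
    by (auto intro!: sum.cong)
  finally show "(\<Sum>u<M. \<Prod>r\<in>{1..2}. (bfly (M div 2) ^^ 0) (?B r) u) / 2 ^ 0 =
      product_sum 2 {g \<in> grid n 2. a 1 (g 1) = a 2 (g 2)} x" .
qed (use assms in auto)

section \<open>Counting solutions of the xor relation\<close>

lemma card_Collect_of_bool:
  assumes "finite A"
  shows "card {x \<in> A. P x} = (\<Sum>x\<in>A. of_bool (P x))"
  using assms by (simp add: Int_def)

text \<open>Given \<open>u\<close>, each further bit of \<open>v\<close> is free and then forces
  that of \<open>w\<close>, so every bit doubles the count.\<close>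

lemma count_xor_rel_pairs:
  assumes "\<And>u. u < L \<Longrightarrow> (\<Sum>v<L. \<Sum>w<L. of_bool (Z u v w)) = (c::nat)" and "u < 2 ^ b * L"
  shows "(\<Sum>v<2 ^ b * L. \<Sum>w<2 ^ b * L. of_bool (xor_rel Z b u v w)) = 2 ^ b * c"
  using assms(2)
proof (induction b arbitrary: u)
  case (Suc b)
  let ?H = "2 ^ b * L"
  have "(\<Sum>v<2 * ?H. \<Sum>w<2 * ?H. of_bool (xor_rel Z (Suc b) u v w)) =
      (\<Sum>v<?H. \<Sum>w<?H. 2 * of_bool (xor_rel Z b (u div 2) v w) :: nat)"
    unfolding sum_even_odd sum.distrib[symmetric] by (intro sum.cong refl) auto
  also have "\<dots> = 2 * (\<Sum>v<?H. \<Sum>w<?H. of_bool (xor_rel Z b (u div 2) v w))"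
    by (simp only: sum_distrib_left)
  also have "\<dots> = 2 * (2 ^ b * c)"
    using Suc.prems by (subst Suc.IH) auto
  finally show ?case by (simp only: power_Suc mult.assoc)
qed (use assms(1) in auto)

text \<open>Each low bit of \<open>w\<close> is forced by those of \<open>u\<close> and
  \<open>v\<close>, so the bound for the upper parts carries over unchanged.\<close>

lemma count_xor_rel_single:
  assumes "\<And>u v. u < L \<Longrightarrow> v < L \<Longrightarrow> (\<Sum>w<L. of_bool (Z u v w)) \<le> (c::nat)"
    and "u < 2 ^ b * L" "v < 2 ^ b * L"
  shows "(\<Sum>w<2 ^ b * L. of_bool (xor_rel Z b u v w)) \<le> c"
  using assms(2,3)
proof (induction b arbitrary: u v)
  case (Suc b)
  let ?H = "2 ^ b * L"
  have "(\<Sum>w<2 * ?H. of_bool (xor_rel Z (Suc b) u v w)) =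
      (\<Sum>w<?H. of_bool (xor_rel Z b (u div 2) (v div 2) w) :: nat)"
    unfolding sum_even_odd by (intro sum.cong refl) auto
  also have "\<dots> \<le> c"
    using Suc.prems by (intro Suc.IH) auto
  finally show ?case by (simp only: power_Suc mult.assoc)
qed (use assms(1) in auto)

subsection \<open>Samples for three factors\<close>

text \<open>Symmetry makes the three coordinates interchangeable. Here \<open>c\<close> counts the
  pairs completing one value to a triple and \<open>d\<close> bounds the completions of two values.
  The last condition has \<open>d - 1\<close> because a triple is itself one of the completions of
  its two shared values.\<close>

locale symmetric_pattern =
  fixes N c d :: nat and P :: "nat \<Rightarrow> nat \<Rightarrow> nat \<Rightarrow> bool"
  assumes swap: "P u v w \<longleftrightarrow> P v u w" "P u v w \<longleftrightarrow> P u w v"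
    and pairs: "u < N \<Longrightarrow> (\<Sum>v<N. \<Sum>w<N. of_bool (P u v w)) = c"
    and single: "u < N \<Longrightarrow> v < N \<Longrightarrow> (\<Sum>w<N. of_bool (P u v w)) \<le> d"
    and spread: "N * (d - 1) \<le> c"
begin

definition T :: "(nat \<Rightarrow> nat) set" where
  "T = {t \<in> {1..3} \<rightarrow>\<^sub>E {..<N}. P (t 1) (t 2) (t 3)}"

lemma card_T: "card T = N * c"
proof -
  have "card T = (\<Sum>t\<in>{1..3::nat} \<rightarrow>\<^sub>E {..<N}. (\<lambda>(u, v, w). of_bool (P u v w)) (t 1, t 2, t 3))"
    unfolding T_def by (subst card_Collect_of_bool) (auto intro: finite_PiE)
  also have "\<dots> = (\<Sum>(u, v, w)\<in>{..<N} \<times> {..<N} \<times> {..<N}. of_bool (P u v w))"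
    by (rule sum.reindex_bij_betw[OF bij_betw_PiE3])
  also have "\<dots> = (\<Sum>u<N. \<Sum>v<N. \<Sum>w<N. of_bool (P u v w))"
    by (simp add: sum.cartesian_product del: sum_of_bool_eq)
  also have "\<dots> = (\<Sum>u<N. c)"
    by (intro sum.cong) (simp_all add: pairs del: sum_of_bool_eq)
  finally show ?thesis by simp
qed

text \<open>If nothing is shared, the neighbours are a subset of \<open>T\<close>. One shared
  coordinate leaves at most \<open>c\<close> pairs, and \<open>N * c = card T\<close>. Two shared
  coordinates leave at most \<open>d - 1\<close> other values of the third, and
  \<open>spread\<close> gives \<open>N ^ 2 * (d - 1) \<le> N * c\<close>.\<close>

lemma T_spread:
  assumes t: "t \<in> T" and A: "A \<subset> {1..3}"
  shows "N ^ card A * card {t' \<in> T. {k \<in> {1..3}. t k = t' k} = A} \<le> card T" (is "_ * card ?B \<le> _")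
proof -
  have fin: "finite T"
    by (rule finite_subset[of _ "{1..3} \<rightarrow>\<^sub>E {..<N}"]) (auto simp: T_def intro: finite_PiE)
  \<comment> \<open>Orderings of the three coordinates, so that symmetry reduces the subsets
    \<open>A\<close> of equal size to one case each.\<close>
  define ijk where "ijk i j k \<longleftrightarrow> i \<in> {1..3} \<and> j \<in> {1..3} \<and> k \<in> {1..3} \<and> i \<noteq> j \<and> i \<noteq> k \<and> j \<noteq> k"
    for i j k :: nat
  have 123: "{1..3} = {1, 2, 3::nat}" by auto
  have ijk: "i = 1 \<and> j = 2 \<and> k = 3 \<or> i = 1 \<and> j = 3 \<and> k = 2 \<or> i = 2 \<and> j = 1 \<and> k = 3 \<or>
      i = 2 \<and> j = 3 \<and> k = 1 \<or> i = 3 \<and> j = 1 \<and> k = 2 \<or> i = 3 \<and> j = 2 \<and> k = 1"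
    if "ijk i j k" for i j k
    using that unfolding ijk_def 123 by auto
  have T_P: "P (s i) (s j) (s k)" if "s \<in> T" "ijk i j k" for s i j k
  proof -
    have P: "P (s 1) (s 2) (s 3)" using that(1) by (simp add: T_def)
    then have "P (s 1) (s 3) (s 2)" "P (s 2) (s 1) (s 3)" using swap by blast+
    moreover from this have "P (s 3) (s 1) (s 2)" "P (s 2) (s 3) (s 1)" using swap by blast+
    moreover from this have "P (s 3) (s 2) (s 1)" using swap by blast
    ultimately show ?thesis
      using ijk[OF that(2)] P by blast
  qed
  have T_less: "s i < N" if "s \<in> T" "i \<in> {1..3}" for s i
    using that PiE_mem[of s "{1..3}" "\<lambda>_. {..<N}" i] by (simp add: T_def)
  have T_eq: "s = s'" if "s \<in> T" "s' \<in> T" "ijk i j k" "s i = s' i" "s j = s' j" "s k = s' k" for s s' i j k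
  proof (rule PiE_ext[of s "{1..3}" "\<lambda>_. {..<N}"])
    show "s l = s' l" if "l \<in> {1..3}" for l
      using that ijk[OF \<open>ijk i j k\<close>] \<open>s i = s' i\<close> \<open>s j = s' j\<close> \<open>s k = s' k\<close> unfolding 123 by auto
  qed (use that(1,2) in \<open>auto simp: T_def\<close>)
  have agree_iff: "t' i = t i \<longleftrightarrow> i \<in> A" if "t' \<in> ?B" "i \<in> {1..3}" for t' i
  proof -
    have "i \<in> A \<longleftrightarrow> i \<in> {k \<in> {1..3}. t k = t' k}" using that(1) by simp
    then show ?thesis using that(2) by (auto simp del: atLeastAtMost_iff)
  qed
  then have agree: "t' i = t i" if "t' \<in> ?B" "i \<in> A" for t' i
    using that A by blast
  consider "A = {}" | i j k where "ijk i j k" "A = {i}"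
    | i j k where "ijk i j k" "A = {i, j}"
  proof -
    have "A \<in> Pow {1, 2, 3} - {{1, 2, 3}}" using A unfolding 123 by auto
    then have "A \<in> {{}, {1}, {2}, {3}, {1, 2}, {1, 3}, {2, 3}}"
      by (auto simp: Pow_insert)
    then consider "A = {}" | "A = {1}" | "A = {2}" | "A = {3}" | "A = {1, 2}" | "A = {1, 3}" | "A = {2, 3}"
      by auto
    then show ?thesis
    proof cases
      case 1 then show ?thesis using that(1) by blast
    next
      case 2 then show ?thesis using that(2)[of 1 2 3] by (simp add: ijk_def)
    next
      case 3 then show ?thesis using that(2)[of 2 1 3] by (simp add: ijk_def)
    next
      case 4 then show ?thesis using that(2)[of 3 1 2] by (simp add: ijk_def)
    next
      case 5 then show ?thesis using that(3)[of 1 2 3] by (simp add: ijk_def)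
    next
      case 6 then show ?thesis using that(3)[of 1 3 2] by (simp add: ijk_def)
    next
      case 7 then show ?thesis using that(3)[of 2 3 1] by (simp add: ijk_def)
    qed
  qed
  then show ?thesis
  proof cases
    case 1
    then show ?thesis using card_mono[OF fin, of ?B] by auto
  next
    case 2
    have "inj_on (\<lambda>t'. (t' j, t' k)) ?B"
    proof (rule inj_onI)
      fix x y assume xy: "x \<in> ?B" "y \<in> ?B" "(x j, x k) = (y j, y k)"
      then have "x i = y i" using agree[OF xy(1), of i] agree[OF xy(2), of i] 2(2) by simp
      then show "x = y" using xy by (intro T_eq[OF _ _ 2(1)]) simp_all
    qed
    moreover have "(\<lambda>t'. (t' j, t' k)) ` ?B \<subseteq> {x \<in> {..<N} \<times> {..<N}. P (t i) (fst x) (snd x)}"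
    proof (intro image_subsetI)
      fix t' assume t': "t' \<in> ?B"
      then have "P (t' i) (t' j) (t' k)" "t' j < N" "t' k < N"
        using T_P[OF _ 2(1), of t'] T_less[of t'] 2(1) by (auto simp: ijk_def)
      then show "(t' j, t' k) \<in> {x \<in> {..<N} \<times> {..<N}. P (t i) (fst x) (snd x)}"
        using agree[OF t', of i] 2(2) by simp
    qed
    ultimately have "card ?B \<le> card {x \<in> {..<N} \<times> {..<N}. P (t i) (fst x) (snd x)}"
      by (rule card_inj_on_le) simp
    also have "\<dots> = (\<Sum>x\<in>{..<N} \<times> {..<N}. of_bool (P (t i) (fst x) (snd x)))"
      by (rule card_Collect_of_bool) auto
    also have "\<dots> = (\<Sum>v<N. \<Sum>w<N. of_bool (P (t i) v w))"
      by (simp add: sum.cartesian_product split_def del: sum_of_bool_eq)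
    also have "\<dots> = c"
      using 2(1) t by (intro pairs T_less) (auto simp: ijk_def)
    finally show ?thesis using 2(2) by (simp add: card_T)
  next
    case 3
    have ne: "t' k \<noteq> t k" if "t' \<in> ?B" for t'
      using agree_iff[OF that, of k] 3 by (simp add: ijk_def del: atLeastAtMost_iff)
    let ?C = "{w \<in> {..<N}. P (t i) (t j) w}"
    have "inj_on (\<lambda>t'. t' k) ?B"
    proof (rule inj_onI)
      fix x y assume xy: "x \<in> ?B" "y \<in> ?B" "x k = y k"
      then have "x i = y i" "x j = y j"
        using agree[OF xy(1), of i] agree[OF xy(2), of i] agree[OF xy(1), of j] agree[OF xy(2), of j] 3(2)
        by simp_all
      then show "x = y" using xy by (intro T_eq[OF _ _ 3(1)]) simp_all
    qed
    moreover have "(\<lambda>t'. t' k) ` ?B \<subseteq> ?C - {t k}"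
    proof (intro image_subsetI)
      fix t' assume t': "t' \<in> ?B"
      then have "P (t' i) (t' j) (t' k)" "t' k < N"
        using T_P[OF _ 3(1), of t'] T_less[of t'] 3(1) by (auto simp: ijk_def)
      then show "t' k \<in> ?C - {t k}"
        using agree[OF t', of i] agree[OF t', of j] ne[OF t'] 3(2) by simp
    qed
    ultimately have "card ?B \<le> card (?C - {t k})"
      by (rule card_inj_on_le) auto
    \<comment> \<open>Agreement exactly on \<open>A\<close> excludes the value \<open>t k\<close>,
      which is itself a completion; this gains the 1 in \<open>d - 1\<close>.\<close>
    also have "t k \<in> ?C"
      using T_P[OF t 3(1)] T_less[OF t] 3(1) by (auto simp: ijk_def)
    then have "card (?C - {t k}) = card ?C - 1" by simp
    also have "card ?C = (\<Sum>w<N. of_bool (P (t i) (t j) w))"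
      by (rule card_Collect_of_bool) auto
    also have "\<dots> \<le> d"
      using 3(1) t by (intro single T_less) (auto simp: ijk_def)
    finally have "card ?B \<le> d - 1" by simp
    then have "N * (N * card ?B) \<le> N * (N * (d - 1))" by simp
    also have "\<dots> \<le> N * c" using spread by (rule mult_left_mono) simp
    finally show ?thesis using 3 by (simp add: card_T ijk_def power2_eq_square mult.assoc)
  qed
qed

lemma p_sample_T:
  assumes "n < N" "5 \<le> N" "0 < p" "p / 2 \<le> real c / real N ^ 2" "real c / real N ^ 2 \<le> p"
  shows "p_sample p (grid n 3) (pattern_sample n 3 N T)"
proof (rule p_sample_pattern)
  \<comment> \<open>5 is the least positive \<open>N\<close> satisfying the inequality:
    \<open>125 \<le> 128\<close>, while \<open>64 > 54\<close>.\<close>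
  obtain M where N: "N = M + 5" using \<open>5 \<le> N\<close> by (metis le_add_diff_inverse2)
  show "N ^ 3 \<le> 2 * (N - 1) ^ 3"
    unfolding N by (simp add: power3_eq_cube algebra_simps)
  have "real (card T) / real N ^ 3 = real c / real N ^ 2"
    using \<open>5 \<le> N\<close> by (simp add: card_T power2_eq_square power3_eq_cube)
  then show "p / 2 \<le> real (card T) / real N ^ 3" "real (card T) / real N ^ 3 \<le> p"
    using assms(4,5) by linarith+
qed (use assms T_spread in \<open>auto simp: T_def\<close>)

lemma set_pattern_sample_T:
  assumes "S \<in> set_pmf (pattern_sample n 3 N T)" "n < N"
  obtains h :: "nat \<Rightarrow> nat \<Rightarrow> nat" where "S = {g \<in> grid n 3. P (h 1 (g 1)) (h 2 (g 2)) (h 3 (g 3))}"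
    and "\<And>k i. k \<in> {1..3} \<Longrightarrow> i \<in> {1..n} \<Longrightarrow> h k i < N"
proof -
  obtain h :: "nat \<Rightarrow> nat \<Rightarrow> nat" where h: "S = pattern_set n 3 T h" "\<And>k i. k \<in> {1..3} \<Longrightarrow> i \<in> {1..n} \<Longrightarrow> h k i < N"
    using set_pattern_sample[OF assms] by metis
  have "(\<lambda>k\<in>{1..3}. h k (g k)) \<in> {1..3} \<rightarrow>\<^sub>E {..<N}" if "g \<in> grid n 3" for g
    unfolding restrict_PiE_iff
  proof
    fix k :: nat assume k: "k \<in> {1..3}"
    then have "g k \<in> {1..n}" using that unfolding grid_def by (rule PiE_mem[rotated])
    then show "h k (g k) \<in> {..<N}" using h(2)[OF k] by simp
  qed
  then have "S = {g \<in> grid n 3. P (h 1 (g 1)) (h 2 (g 2)) (h 3 (g 3))}"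
    unfolding h(1) pattern_set_def T_def by auto
  then show ?thesis using h(2) that by blast
qed

end

text \<open>The free upper parts contribute a factor \<open>L\<close> for each further value; the
  resulting density is \<open>1 / 2 ^ b\<close>.\<close>

lemma symmetric_pattern_True:
  "symmetric_pattern (2 ^ b * L) (2 ^ b * L ^ 2) L (xor_rel (\<lambda>u v w. True) b)"
proof
  show "(\<Sum>v<2 ^ b * L. \<Sum>w<2 ^ b * L. of_bool (xor_rel (\<lambda>u v w. True) b u v w)) = 2 ^ b * L\<^sup>2"
    if "u < 2 ^ b * L" for u
    by (rule count_xor_rel_pairs[OF _ that]) (simp add: power2_eq_square)
  show "(\<Sum>w<2 ^ b * L. of_bool (xor_rel (\<lambda>u v w. True) b u v w)) \<le> L"
    if "u < 2 ^ b * L" "v < 2 ^ b * L" for u v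
    by (rule count_xor_rel_single[OF _ that]) simp
  show "2 ^ b * L * (L - 1) \<le> 2 ^ b * L\<^sup>2"
    by (simp add: power2_eq_square)
qed (rule xor_rel_swap xor_rel_swap'; simp)+

text \<open>Two values determine the third, so \<open>d = 1\<close> and the spread condition is
  trivial; the density is \<open>2 ^ b / N ^ 2\<close>.\<close>

lemma symmetric_pattern_eq3:
  "symmetric_pattern (2 ^ b * L) (2 ^ b) 1 (xor_rel eq3 b)"
proof
  have 1: "(\<Sum>w<L. of_bool (eq3 u v w)) = (of_bool (u = v) :: nat)" if "v < L" for u v
  proof -
    have "(\<Sum>w<L. of_bool (eq3 u v w)) = (\<Sum>w<L. if w = v then of_bool (u = v) else 0 :: nat)"
      by (intro sum.cong) (auto simp: eq3_def)
    also have "\<dots> = of_bool (u = v)" using that by simp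
    finally show ?thesis .
  qed
  have 2: "(\<Sum>v<L. \<Sum>w<L. of_bool (eq3 u v w)) = (1::nat)" if "u < L" for u
  proof -
    have "(\<Sum>v<L. \<Sum>w<L. of_bool (eq3 u v w)) = (\<Sum>v<L. if v = u then 1 else 0 :: nat)"
      by (intro sum.cong refl) (auto simp: 1 simp del: sum_of_bool_eq)
    also have "\<dots> = 1" using that by simp
    finally show ?thesis .
  qed
  show "(\<Sum>v<2 ^ b * L. \<Sum>w<2 ^ b * L. of_bool (xor_rel eq3 b u v w)) = (2 ^ b :: nat)"
    if "u < 2 ^ b * L" for u
    using count_xor_rel_pairs[where Z = eq3 and L = L and c = 1, OF 2 that] by (simp del: sum_of_bool_eq)
  show "(\<Sum>w<2 ^ b * L. of_bool (xor_rel eq3 b u v w)) \<le> (1 :: nat)"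
    if "u < 2 ^ b * L" "v < 2 ^ b * L" for u v
    by (rule count_xor_rel_single[OF _ that]) (simp add: 1 del: sum_of_bool_eq)
qed (rule xor_rel_swap xor_rel_swap'; auto simp: eq3_def | simp)+

text \<open>Renames arbitrarily large colours to addresses at most \<open>n\<close>; colours missed by \<open>c 1\<close> go to 0.\<close>

lemma relabel:
  fixes c :: "nat \<Rightarrow> nat \<Rightarrow> nat"
  obtains a where "\<And>r i. a r i < n + 1"
    and "\<And>r i j. i \<in> {1..n} \<Longrightarrow> a 1 i = a r j \<longleftrightarrow> c 1 i = c r j"
proof -
  define f where "f v = (if v \<in> c 1 ` {1..n} then inv_into {1..n} (c 1) v else 0)" for v
  have f_le: "f v \<le> n" for v
    using inv_into_into[of v "c 1" "{1..n}"] by (auto simp: f_def)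
  have f_pos: "f v \<noteq> 0 \<and> c 1 (f v) = v" if "v \<in> c 1 ` {1..n}" for v
    using inv_into_into[OF that] f_inv_into_f[OF that] that by (auto simp: f_def)
  have "f (c 1 i) = f (c r j) \<longleftrightarrow> c 1 i = c r j" if "i \<in> {1..n}" for r i j
  proof
    assume eq: "f (c 1 i) = f (c r j)"
    have 1: "f (c 1 i) \<noteq> 0 \<and> c 1 (f (c 1 i)) = c 1 i" using f_pos that by blast
    then have "c r j \<in> c 1 ` {1..n}" using eq by (auto simp: f_def split: if_splits)
    then show "c 1 i = c r j" using f_pos eq 1 by metis
  qed simp
  then show ?thesis
    using that[of "\<lambda>r i. f (c r i)"] f_le by (simp add: less_Suc_eq_le)
qed

text \<open>The densities \<open>1 / 2 ^ e\<close> down to \<open>1 / N\<close>, then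
  \<open>2 ^ e / N ^ 2\<close> down to \<open>1 / N ^ 2\<close>, and finally
  \<open>1 / M ^ 2\<close> for larger \<open>M\<close> approximate every \<open>p\<close> from below
  within a factor 2.\<close>

lemma exists_summable_sample_3:
  fixes n :: nat and p :: real
  assumes "1 \<le> n" and p: "0 < p" "p \<le> 1"
  shows "\<exists>D. p_sample p (grid n 3) D \<and> (\<forall>S\<in>set_pmf D. sums_within ((n + 1) ^ 10) (summation 3) 3 n S
    (7000 * real (n + 1) * (log 2 (real (n + 7)) + 2)))"
proof -
  let ?\<tau> = "7000 * real (n + 1) * (log 2 (real (n + 7)) + 2)"
  \<comment> \<open>\<open>N\<close> will be the power of two just above \<open>n + 7\<close>, so
    \<open>n < N\<close>, \<open>5 \<le> N\<close> and
    \<open>N \<le> 2 * (n + 7) \<le> 16 * (n + 1)\<close>.\<close>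
  obtain k' where k': "2 ^ k' \<le> n + 7" "n + 7 < 2 ^ (k' + 1)"
    using ex_power_ivl1[of 2 "n + 7"] by auto
  define k where "k = k' + 1"
  define N where "N = (2::nat) ^ k"
  have N: "n + 7 < N" "N \<le> 16 * (n + 1)" "n < N" "5 \<le> N"
    using k' by (auto simp: N_def k_def)
  \<comment> \<open>At most \<open>k = k' + 1\<close> rounds are ever used, and \<open>k'\<close> is
    at most the logarithm of \<open>n + 7\<close>.\<close>
  have \<tau>: "7000 * real (n + 1) * real (b + 1) \<le> ?\<tau>" if "b \<le> k" for b
  proof -
    have "2 ^ k' \<le> real (n + 7)" using k'(1)[THEN of_nat_mono[where 'a = real]] by simp
    then have "real k' \<le> log 2 (real (n + 7))" by (simp add: le_log_iff powr_realpow)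
    then show ?thesis using that by (intro mult_left_mono) (auto simp: k_def)
  qed
  consider "1 / p \<le> real N" | "real N < 1 / p" "1 / p \<le> real N ^ 2" | "real N ^ 2 < 1 / p"
    by linarith
  then show ?thesis
  proof cases
    case 1
    \<comment> \<open>The largest density \<open>1 / 2 ^ e\<close> not above \<open>p\<close>. It is
      at least \<open>p / 2\<close> by minimality of \<open>e\<close>, or by
      \<open>p \<le> 1\<close> if \<open>e = 0\<close>.\<close>
    define e where "e = (LEAST e. 1 / p \<le> 2 ^ e)"
    have *: "1 / p \<le> 2 ^ k" using 1 by (simp add: N_def)
    have e: "1 / p \<le> 2 ^ e" "e \<le> k"
      unfolding e_def using LeastI[of "\<lambda>e. 1 / p \<le> 2 ^ e", OF *] Least_le[of "\<lambda>e. 1 / p \<le> 2 ^ e", OF *] by blast+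
    have e': "2 ^ e \<le> 2 / p"
    proof (cases e)
      case 0
      then show ?thesis using p by (simp add: field_simps)
    next
      case (Suc e')
      then have "\<not> 1 / p \<le> 2 ^ e'" using not_less_Least[of e' "\<lambda>e. 1 / p \<le> 2 ^ e"] e_def by simp
      then show ?thesis using Suc by simp
    qed
    define L where "L = (2::nat) ^ (k - e)"
    have NL: "N = 2 ^ e * L" using e(2) by (simp add: N_def L_def flip: power_add)
    interpret symmetric_pattern N "2 ^ e * L ^ 2" L "xor_rel (\<lambda>u v w. True) e"
      unfolding NL by (rule symmetric_pattern_True)
    have dens: "real (2 ^ e * L\<^sup>2) / (real N)\<^sup>2 = 1 / 2 ^ e"
      unfolding NL by (simp add: power2_eq_square L_def)
    have "1 / 2 ^ e \<le> p" "p / 2 \<le> 1 / 2 ^ e"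
      using p e(1) e' by (simp_all add: field_simps)
    then have "p_sample p (grid n 3) (pattern_sample n 3 N T)"
      unfolding dens[symmetric] using N p by (intro p_sample_T)
    moreover have "sums_within ((n + 1) ^ 10) (summation 3) 3 n S ?\<tau>"
      if S: "S \<in> set_pmf (pattern_sample n 3 N T)" for S
    proof -
      obtain h :: "nat \<Rightarrow> nat \<Rightarrow> nat" where h: "S = {g \<in> grid n 3. xor_rel (\<lambda>u v w. True) e (h 1 (g 1)) (h 2 (g 2)) (h 3 (g 3))}"
          "\<And>k i. k \<in> {1..3} \<Longrightarrow> i \<in> {1..n} \<Longrightarrow> h k i < N"
        by (rule set_pattern_sample_T[OF S N(3)]) (rule that)
      \<comment> \<open>\<open>xor_rel_mod\<close> turns the pattern into one on residues, so
        \<open>2 ^ e\<close> cells suffice.\<close>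
      have "2 ^ e \<le> N" using e(2) by (simp add: N_def)
      then show ?thesis
        unfolding h(1) xor_rel_mod
        by (intro sums_within_xor[where M = "2 ^ e" and a = "\<lambda>r i. h r i mod 2 ^ e"])
          (use \<open>1 \<le> n\<close> N(2) \<tau> e(2) in auto)
    qed
    ultimately show ?thesis by blast
  next
    case 2
    \<comment> \<open>Chosen so that \<open>2 ^ e \<le> p * N ^ 2 < 2 ^ (e + 1)\<close>. For
      \<open>e = 0\<close> the lower bound is the case assumption; \<open>e \<le> k\<close> comes
      from \<open>p * N < 1\<close>.\<close>
    define e where "e = (LEAST e. p * real N ^ 2 < 2 ^ (e + 1))"
    have "p * real N < 1" using 2(1) p by (simp add: field_simps)
    then have "p * real N * real N < 1 * real N" using N by (intro mult_strict_right_mono) auto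
    then have "p * real N ^ 2 < 2 ^ k" by (simp add: N_def power2_eq_square mult.assoc)
    also have "(2::real) ^ k \<le> 2 ^ (k + 1)" by simp
    finally have *: "p * real N ^ 2 < 2 ^ (k + 1)" .
    have e: "p * real N ^ 2 < 2 ^ (e + 1)" "e \<le> k"
      unfolding e_def using LeastI[of "\<lambda>e. p * real N ^ 2 < 2 ^ (e + 1)", OF *]
        Least_le[of "\<lambda>e. p * real N ^ 2 < 2 ^ (e + 1)", OF *] by blast+
    have e': "2 ^ e \<le> p * real N ^ 2"
    proof (cases e)
      case 0
      then show ?thesis using p 2(2) by (simp add: field_simps)
    next
      case (Suc e')
      then have "\<not> p * real N ^ 2 < 2 ^ (e' + 1)"
        using not_less_Least[of e' "\<lambda>e. p * real N ^ 2 < 2 ^ (e + 1)"] e_def by simp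
      then show ?thesis using Suc by simp
    qed
    have NL: "N = 2 ^ e * 2 ^ (k - e)" using e(2) by (simp add: N_def flip: power_add)
    interpret symmetric_pattern N "2 ^ e" 1 "xor_rel eq3 e"
      unfolding NL by (rule symmetric_pattern_eq3)
    have "p_sample p (grid n 3) (pattern_sample n 3 N T)"
      using N p e(1) e' by (intro p_sample_T) (auto simp: field_simps)
    moreover have "sums_within ((n + 1) ^ 10) (summation 3) 3 n S ?\<tau>"
      if S: "S \<in> set_pmf (pattern_sample n 3 N T)" for S
    proof -
      obtain h :: "nat \<Rightarrow> nat \<Rightarrow> nat" where h: "S = {g \<in> grid n 3. xor_rel eq3 e (h 1 (g 1)) (h 2 (g 2)) (h 3 (g 3))}"
          "\<And>k i. k \<in> {1..3} \<Longrightarrow> i \<in> {1..n} \<Longrightarrow> h k i < N"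
        by (rule set_pattern_sample_T[OF S N(3)]) (rule that)
      have "2 ^ e dvd N" by (simp add: NL)
      then show ?thesis
        unfolding h(1) by (intro sums_within_xor[where M = N]) (use \<open>1 \<le> n\<close> N(2) \<tau> e(2) h(2) in auto)
    qed
    ultimately show ?thesis by blast
  next
    case 3
    \<comment> \<open>Least with \<open>1 / M ^ 2 \<le> p\<close>. Failure at \<open>M - 1\<close>
      together with \<open>M ^ 2 \<le> 2 * (M - 1) ^ 2\<close> shows that the density is at least
      \<open>p / 2\<close>.\<close>
    define M where "M = (LEAST M. 1 / p \<le> real M ^ 2)"
    obtain j where "1 / p \<le> real j" using real_arch_simple by blast
    also have "real j \<le> real j ^ 2" by (cases j) (auto simp: power2_eq_square)
    finally have M1: "1 / p \<le> real M ^ 2"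
      unfolding M_def by (rule LeastI[of "\<lambda>M. 1 / p \<le> real M ^ 2"])
    have "real N ^ 2 < real M ^ 2" using 3 M1 by linarith
    then have "real N < real M" by (rule power_less_imp_less_base) simp
    then have NM: "N < M" by simp
    have "\<not> 1 / p \<le> real (M - 1) ^ 2"
      using not_less_Least[of "M - 1" "\<lambda>M. 1 / p \<le> real M ^ 2"] NM by (simp add: M_def[symmetric])
    moreover have "real M ^ 2 \<le> 2 * real (M - 1) ^ 2"
    proof -
      have "real (M - 1) = real M - 1" "5 \<le> real M" using NM N by auto
      moreover have "x ^ 2 \<le> 2 * (x - 1) ^ 2" if "5 \<le> x" for x :: real
      proof -
        \<comment> \<open>The right side is \<open>2 * (x - 1) ^ 2 - x ^ 2\<close>.\<close>
        have "0 \<le> (x - 5) * (x + 1) + 7" using that by simp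
        then show ?thesis by (simp add: power2_eq_square algebra_simps)
      qed
      ultimately show ?thesis by simp
    qed
    ultimately have M2: "real M ^ 2 \<le> 2 / p" by simp
    interpret symmetric_pattern M 1 1 "xor_rel eq3 0"
      using symmetric_pattern_eq3[of 0 M] by (simp only: power_0 mult_1)
    have "n < M" "5 \<le> M" using NM N by auto
    then have "p_sample p (grid n 3) (pattern_sample n 3 M T)"
      using p M1 M2 by (intro p_sample_T) (auto simp: field_simps)
    moreover have "sums_within ((n + 1) ^ 10) (summation 3) 3 n S ?\<tau>"
      if S: "S \<in> set_pmf (pattern_sample n 3 M T)" for S
    proof -
      obtain h :: "nat \<Rightarrow> nat \<Rightarrow> nat" where h: "S = {g \<in> grid n 3. xor_rel eq3 0 (h 1 (g 1)) (h 2 (g 2)) (h 3 (g 3))}"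
          "\<And>k i. k \<in> {1..3} \<Longrightarrow> i \<in> {1..n} \<Longrightarrow> h k i < M"
        by (rule set_pattern_sample_T[OF S \<open>n < M\<close>]) (rule that)
      \<comment> \<open>\<open>M\<close> grows as \<open>p\<close> shrinks and is not bounded in
        \<open>n\<close>. As only equality with the colour of the first coordinate matters, the
        colours are renamed to \<open>n + 1\<close> addresses.\<close>
      obtain a :: "nat \<Rightarrow> nat \<Rightarrow> nat" where a: "\<And>r i. a r i < n + 1"
          "\<And>r i j. i \<in> {1..n} \<Longrightarrow> a 1 i = a r j \<longleftrightarrow> h 1 i = h r j"
        by (rule relabel[of n h]) (rule that)
      have "xor_rel eq3 0 (h 1 (g 1)) (h 2 (g 2)) (h 3 (g 3)) \<longleftrightarrow>
          xor_rel eq3 0 (a 1 (g 1)) (a 2 (g 2)) (a 3 (g 3))" if "g \<in> grid n 3" for g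
      proof -
        have "g 1 \<in> {1..n}" using that unfolding grid_def by (rule PiE_mem) simp
        from a(2)[OF this, of 2 "g 2"] a(2)[OF this, of 3 "g 3"] show ?thesis
          unfolding xor_rel.simps eq3_def by metis
      qed
      then have "S = {g \<in> grid n 3. xor_rel eq3 0 (a 1 (g 1)) (a 2 (g 2)) (a 3 (g 3))}"
        unfolding h(1) by blast
      then show ?thesis
        using a(1) \<open>1 \<le> n\<close> \<tau>[of 0] by (simp only:) (intro sums_within_xor[where M = "n + 1"], auto)
    qed
    ultimately show ?thesis by blast
  qed
qed

subsection \<open>Samples for two factors\<close>

lemma card_div_fibre:
  assumes "0 < B" and "r < K"
  shows "card {v \<in> {..<K * B}. v div B = r} = (B::nat)"
proof -
  have "{v \<in> {..<K * B}. v div B = r} = {r * B..<r * B + B}"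
  proof (intro set_eqI iffI)
    fix v assume "v \<in> {v \<in> {..<K * B}. v div B = r}"
    then show "v \<in> {r * B..<r * B + B}"
      using div_mult_mod_eq[of v B] mod_less_divisor[OF assms(1), of v] by auto
  next
    fix v assume v: "v \<in> {r * B..<r * B + B}"
    then have "v div B = r" by (intro div_nat_eqI) (auto simp: mult.commute)
    moreover have "r * B + B \<le> K * B" using assms(2) by (metis Suc_leI add.commute mult_Suc mult_le_mono1)
    ultimately show "v \<in> {v \<in> {..<K * B}. v div B = r}" using v by auto
  qed
  then show ?thesis by simp
qed

text \<open>\<open>K\<close> consecutive blocks of length \<open>B\<close>; the density is
  \<open>1 / K\<close>.\<close>

definition same_block :: "nat \<Rightarrow> nat \<Rightarrow> (nat \<Rightarrow> nat) set" where
  "same_block K B = {t \<in> {1..2} \<rightarrow>\<^sub>E {..<K * B}. t 1 div B = t 2 div B}"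

lemma same_block_less:
  assumes "t \<in> same_block K B" "i \<in> {1..2}"
  shows "t i < K * B" "t i div B < K"
proof -
  show "t i < K * B"
    using assms PiE_mem[of t "{1..2}" "\<lambda>_. {..<K * B}" i] by (simp add: same_block_def)
  then show "t i div B < K" by (rule less_mult_imp_div_less)
qed

lemma card_same_block:
  assumes "0 < B"
  shows "card (same_block K B) = K * B * B"
proof -
  have "card (same_block K B) =
      (\<Sum>t\<in>{1..2::nat} \<rightarrow>\<^sub>E {..<K * B}. (\<lambda>(u, v). of_bool (u div B = v div B)) (t 1, t 2))"
    unfolding same_block_def by (subst card_Collect_of_bool) (auto intro: finite_PiE)
  also have "\<dots> = (\<Sum>(u, v)\<in>{..<K * B} \<times> {..<K * B}. of_bool (u div B = v div B))"
    by (rule sum.reindex_bij_betw[OF bij_betw_PiE2])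
  also have "\<dots> = (\<Sum>u<K * B. \<Sum>v<K * B. of_bool (v div B = u div B))"
    by (simp add: sum.cartesian_product eq_commute del: sum_of_bool_eq)
  also have "\<dots> = (\<Sum>u<K * B. B)"
  proof (intro sum.cong refl)
    fix u assume "u \<in> {..<K * B}"
    then have "u div B < K" by (simp add: less_mult_imp_div_less)
    then show "(\<Sum>v<K * B. of_bool (v div B = u div B)) = B"
      using card_div_fibre[OF assms] by (subst card_Collect_of_bool[symmetric]) simp_all
  qed
  finally show ?thesis by simp
qed

text \<open>One shared coordinate fixes the block and leaves at most \<open>B\<close> values for the
  other, and \<open>K * B * B\<close> is the size of the pattern.\<close>

lemma same_block_spread:
  assumes "0 < B" and t: "t \<in> same_block K B" and A: "A \<subset> {1..2}"
  shows "(K * B) ^ card A * card {t' \<in> same_block K B. {k \<in> {1..2}. t k = t' k} = A} \<le> card (same_block K B)"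
    (is "_ * card ?B \<le> _")
proof -
  have fin: "finite (same_block K B)"
    by (rule finite_subset[of _ "{1..2} \<rightarrow>\<^sub>E {..<K * B}"]) (auto simp: same_block_def intro: finite_PiE)
  have 12: "{1..2} = {1, 2::nat}" by auto
  have "A \<in> Pow {1, 2} - {{1, 2}}" using A unfolding 12 by auto
  then have "A \<in> {{}, {1}, {2}}" by (auto simp: Pow_insert)
  then consider "A = {}" | i j :: nat where "A = {i}" "i = 1 \<and> j = 2 \<or> i = 2 \<and> j = 1" by blast
  then show ?thesis
  proof cases
    case 1
    then show ?thesis using card_mono[OF fin, of ?B] by auto
  next
    case 2
    have ij: "i \<in> {1..2}" "j \<in> {1..2}" using 2(2) by auto
    have agree: "x i = t i" if "x \<in> ?B" for x
    proof -
      have "i \<in> {k \<in> {1..2}. t k = x k}" using that 2(1) by blast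
      then show ?thesis by simp
    qed
    have "inj_on (\<lambda>x. x j) ?B"
    proof (rule inj_onI)
      fix x y assume xy: "x \<in> ?B" "y \<in> ?B" "x j = y j"
      then have i: "x i = y i" using agree[OF xy(1)] agree[OF xy(2)] by simp
      show "x = y"
      proof (rule PiE_ext[of x "{1..2}" "\<lambda>_. {..<K * B}"])
        show "x k = y k" if "k \<in> {1..2}" for k
          using that 2(2) i xy(3) unfolding 12 by auto
      qed (use xy in \<open>auto simp: same_block_def\<close>)
    qed
    moreover have "(\<lambda>x. x j) ` ?B \<subseteq> {v \<in> {..<K * B}. v div B = t i div B}"
    proof (intro image_subsetI)
      fix x assume x: "x \<in> ?B"
      then have "x j < K * B" "x i div B = x j div B"
        using same_block_less(1)[OF _ ij(2)] 2(2) by (auto simp: same_block_def)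
      then show "x j \<in> {v \<in> {..<K * B}. v div B = t i div B}" using agree[OF x] by simp
    qed
    ultimately have "card ?B \<le> card {v \<in> {..<K * B}. v div B = t i div B}"
      by (rule card_inj_on_le) simp
    also have "\<dots> = B" by (rule card_div_fibre[OF assms(1) same_block_less(2)[OF t ij(1)]])
    finally show ?thesis using 2(1) by (simp add: card_same_block[OF assms(1)])
  qed
qed

lemma exists_summable_sample_2:
  fixes n :: nat and p :: real
  assumes "1 \<le> n" and p: "0 < p" "p \<le> 1"
  shows "\<exists>D. p_sample p (grid n 2) D \<and> (\<forall>S\<in>set_pmf D. sums_within ((n + 1) ^ 10) (summation 2) 2 n S
    (7000 * real (n + 1)))"
proof -
  \<comment> \<open>The fewest blocks with density at most \<open>p\<close>. From
    \<open>K - 1 < 1 / p\<close> and \<open>1 \<le> 1 / p\<close> follows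
    \<open>K \<le> 2 / p\<close>.\<close>
  define K where "K = (LEAST K. 1 / p \<le> real K)"
  \<comment> \<open>Ensures \<open>n < N\<close> and \<open>4 \<le> N\<close> even for a single
    block; 4 is the least positive \<open>N\<close> with
    \<open>N ^ 2 \<le> 2 * (N - 1) ^ 2\<close>.\<close>
  define B where "B = n + 4"
  define N where "N = K * B"
  obtain j where "1 / p \<le> real j" using real_arch_simple by blast
  then have K1: "1 / p \<le> real K"
    unfolding K_def by (rule LeastI[of "\<lambda>K. 1 / p \<le> real K"])
  then have "0 < K" using p by (cases "K = 0") (auto simp: field_simps)
  then have "\<not> 1 / p \<le> real (K - 1)"
    using not_less_Least[of "K - 1" "\<lambda>K. 1 / p \<le> real K"] by (simp add: K_def[symmetric])
  moreover have "1 \<le> 1 / p" using p by simp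
  ultimately have K2: "real K \<le> 2 / p" using \<open>0 < K\<close> by (simp add: of_nat_diff)
  have "B \<le> N" using \<open>0 < K\<close> by (simp add: N_def)
  then have N: "n < N" "4 \<le> N" by (auto simp: B_def)
  have "0 < B" by (simp add: B_def)
  have dens: "real (card (same_block K B)) / real N ^ 2 = 1 / real K"
    using \<open>0 < B\<close> \<open>0 < K\<close> by (simp add: card_same_block N_def power2_eq_square)
  have "p_sample p (grid n 2) (pattern_sample n 2 N (same_block K B))"
  proof (rule p_sample_pattern)
    obtain M where N': "N = M + 4" using \<open>4 \<le> N\<close> by (metis le_add_diff_inverse2)
    show "N ^ 2 \<le> 2 * (N - 1) ^ 2"
      unfolding N' by (simp add: power2_eq_square algebra_simps)
    show "p / 2 \<le> real (card (same_block K B)) / real N ^ 2" "real (card (same_block K B)) / real N ^ 2 \<le> p"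
      unfolding dens using K1 K2 p \<open>0 < K\<close> by (simp_all add: field_simps)
    show "N ^ card A * card {t' \<in> same_block K B. {k \<in> {1..2}. t k = t' k} = A} \<le> card (same_block K B)"
      if "t \<in> same_block K B" "A \<subset> {1..2}" for t A
      unfolding N_def by (rule same_block_spread[OF \<open>0 < B\<close> that])
  qed (use N p in \<open>auto simp: same_block_def N_def\<close>)
  moreover have "sums_within ((n + 1) ^ 10) (summation 2) 2 n S (7000 * real (n + 1))"
    if S: "S \<in> set_pmf (pattern_sample n 2 N (same_block K B))" for S
  proof -
    obtain h where h: "S = pattern_set n 2 (same_block K B) h"
        "\<And>k i. k \<in> {1..2} \<Longrightarrow> i \<in> {1..n} \<Longrightarrow> h k i < N"
      by (rule set_pattern_sample[OF S N(1)]) (rule that)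
    \<comment> \<open>The number of blocks depends on \<open>p\<close>, so block numbers are renamed
      to \<open>n + 1\<close> addresses to keep the time linear in \<open>n\<close>.\<close>
    obtain a :: "nat \<Rightarrow> nat \<Rightarrow> nat" where a: "\<And>r i. a r i < n + 1"
        "\<And>r i j. i \<in> {1..n} \<Longrightarrow> a 1 i = a r j \<longleftrightarrow> h 1 i div B = h r j div B"
      by (rule relabel[of n "\<lambda>r i. h r i div B"]) (rule that)
    have "(\<lambda>k\<in>{1..2}. h k (g k)) \<in> same_block K B \<longleftrightarrow> a 1 (g 1) = a 2 (g 2)"
      if g: "g \<in> grid n 2" for g
    proof -
      have gk: "g k \<in> {1..n}" if "k \<in> {1..2}" for k
        using g that unfolding grid_def by (rule PiE_mem)
      have "(\<lambda>k\<in>{1..2}. h k (g k)) \<in> {1..2} \<rightarrow>\<^sub>E {..<K * B}"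
        unfolding restrict_PiE_iff N_def[symmetric]
      proof
        fix k :: nat assume k: "k \<in> {1..2}"
        show "h k (g k) \<in> {..<N}" using h(2)[OF k gk[OF k]] by simp
      qed
      then show ?thesis using a(2)[OF gk, of 1 2 "g 2"] by (simp add: same_block_def)
    qed
    then have "S = {g \<in> grid n 2. a 1 (g 1) = a 2 (g 2)}"
      unfolding h(1) pattern_set_def by blast
    then show ?thesis
      using a(1) \<open>1 \<le> n\<close> by (simp only:) (intro sums_within_equal_2[where M = "n + 1"], auto)
  qed
  ultimately show ?thesis by blast
qed

subsection \<open>Summation times\<close>

lemma admits_summation_inI:
  assumes "T \<in> F"
    and "\<And>n p S. 1 \<le> n \<Longrightarrow> p \<in> {0<..1} \<Longrightarrow> S \<in> set_pmf (D n p) \<Longrightarrow> sums_within ((n + 1) ^ b) A m n S (T n)"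
  shows "admits_summation_in F m D"
  using assms unfolding admits_summation_in_def by blast

theorem theorem2p4:
  fixes m :: nat
  assumes "m \<in> {2, 3}"
  shows "\<exists>D :: nat \<Rightarrow> real \<Rightarrow> (nat \<Rightarrow> nat) set pmf.
    (\<forall>n\<ge>1. \<forall>p\<in>{0<..1}. p_sample p (grid n m) (D n p)) \<and>
    admits_fast_summation m D \<and>
    (m = 2 \<longrightarrow> admits_summation_in (O(\<lambda>n. real n)) m D) \<and>
    (m = 3 \<longrightarrow> admits_summation_in (O(\<lambda>n. real n * ln (real n) ^ 2)) m D)"
proof -
  define T :: "nat \<Rightarrow> real" where
    "T = (\<lambda>n. if m = 2 then 7000 * real (n + 1)
      else 7000 * real (n + 1) * (log 2 (real (n + 7)) + 2))"
  \<comment> \<open>The range conditions sit under the existential, so that a sample can be chosen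
    for all \<open>n\<close> and \<open>p\<close> at once; program and time bound are already
    fixed.\<close>
  have "\<forall>n p. \<exists>D. 1 \<le> n \<and> p \<in> {0<..1} \<longrightarrow> p_sample p (grid n m) D \<and>
      (\<forall>S\<in>set_pmf D. sums_within ((n + 1) ^ 10) (summation m) m n S (T n))"
    using assms exists_summable_sample_2 exists_summable_sample_3 by (auto simp: T_def)
  then obtain D where D: "\<And>n p. 1 \<le> n \<Longrightarrow> p \<in> {0<..1} \<Longrightarrow> p_sample p (grid n m) (D n p) \<and>
      (\<forall>S\<in>set_pmf (D n p). sums_within ((n + 1) ^ 10) (summation m) m n S (T n))"
    by metis
  have admits: "admits_summation_in F m D" if "T \<in> F" for F
    using that by (rule admits_summation_inI) (use D in blast)
  have T: "T \<in> O(\<lambda>n. real n)" if "m = 2"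
    using that unfolding T_def by simp real_asymp
  \<comment> \<open>The bound for three factors is of order \<open>n * ln n\<close>, below the
    \<open>n * ln n ^ 2\<close> asked for. Landau sets concern large \<open>n\<close>, so the zero
    of the logarithm at \<open>n = 1\<close> is harmless.\<close>
  have T': "T \<in> O(\<lambda>n. real n * ln (real n) ^ 2)" if "m = 3"
    using that unfolding T_def by simp real_asymp
  \<comment> \<open>The exponent 1 of the logarithm is the witness for \<open>soft_O\<close> in both
    cases.\<close>
  have "T \<in> O(\<lambda>n. real (m * n) * ln (real (m * n)) ^ 1)"
  proof (cases "m = 2")
    case True
    then show ?thesis unfolding T_def by simp real_asymp
  next
    case False
    then have "m = 3" using assms by simp
    then show ?thesis unfolding T_def by simp real_asymp
  qed
  then have "T \<in> soft_O (\<lambda>n. real (m * n))"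
    unfolding soft_O_def by blast
  then show ?thesis
    unfolding admits_fast_summation_def using D admits T T' by blast
qed

end
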